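(* Let $P$ be a polygon and let $W$ be a finite collection of finite words in its bounce language $\mathcal{L}_P$. Then there exists $\varepsilon>0$ such that $W\subset\mathcal{L}_Q$ for all $Q\in P_\varepsilon$.
   Context: Let $P(z_1,\dots,z_n)$ denote the polygon in $\mathbb{C}$ with vertices $z_1,\dots,z_n$ in cyclic order, so that its edges join $z_i$ to $z_{i+1}$ (indices mod $n$). Polygons are considered up to similarity and normalized so that $z_1=0$, $z_2=1$ and $\operatorname{Im}(z_3)\ge 0$. For $P=P(0,1,z_3,\dots,z_n)$ and $\varepsilon>0$, $P_\varepsilon=\{P(0,1,t_3,\dots,t_n): |t_i-z_i|<\varepsilon \text{ for all } i\}$ (a set of polygons with $n$ edges). The edges of $P$ are labeled by distinct letters of a finite alphabet $\mathcal{A}$, and each $Q\in P_\varepsilon$ carries the corresponding labeling: the edge from $t_i$ to $t_{i+1}$ has the same label as the edge of $P$ from $z_i$ to $z_{i+1}$. A billiard trajectory on a polygon moves along straight lines and reflects optically at interior points of edges; it is singular if it ever hits a vertex. The bounce sequence of a nonsingular bi-infinite trajectory is the $\mathbb{Z}$-indexed sequence of labels of the edges it hits. The bounce language $\mathcal{L}_P\subset\mathcal{A}^*$ is the set of all finite subwords (of consecutive letters) of bounce sequences of nonsingular bi-infinite trajectories on $P$. *)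

theory Defs
  imports "HOL-Analysis.Analysis"
begin

text \<open>
  A polygon is given by the list of its vertices in cyclic order. Vertices and edges are counted
  from 0, so edge \<open>i\<close> joins vertex \<open>i\<close> to vertex \<open>i + 1\<close> modulo the number of vertices.
\<close>

definition next_vertex :: "complex list \<Rightarrow> nat \<Rightarrow> complex" where
  "next_vertex zs i = zs ! (Suc i mod length zs)"

definition edge :: "complex list \<Rightarrow> nat \<Rightarrow> complex set" where
  "edge zs i = closed_segment (zs ! i) (next_vertex zs i)"

definition edge_interior :: "complex list \<Rightarrow> nat \<Rightarrow> complex set" where
  "edge_interior zs i = open_segment (zs ! i) (next_vertex zs i)"

definition polygon_boundary :: "complex list \<Rightarrow> complex set" where
  "polygon_boundary zs = (\<Union>i<length zs. edge zs i)"

text \<open>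
  Polygons are simple: two different edges meet at most in a common endpoint. An angle
  of \<open>\<pi>\<close> at a vertex is allowed, and both orientations of the boundary are allowed.
\<close>

definition polygon :: "complex list \<Rightarrow> bool" where
  "polygon zs \<longleftrightarrow> 3 \<le> length zs \<and> distinct zs \<and>
     (\<forall>i<length zs. \<forall>j<length zs. i \<noteq> j \<longrightarrow>
        edge zs i \<inter> edge zs j = {zs ! i, next_vertex zs i} \<inter> {zs ! j, next_vertex zs j})"

definition normalized_polygon :: "complex list \<Rightarrow> bool" where
  "normalized_polygon zs \<longleftrightarrow> polygon zs \<and> zs ! 0 = 0 \<and> zs ! 1 = 1 \<and> 0 \<le> Im (zs ! 2)"

text \<open>
  All vertex tuples near \<open>zs\<close> are admitted. If \<open>zs\<close> is a polygon and \<open>\<epsilon>\<close> is small, then they are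
  polygons themselves. The third vertex of a nearby tuple may lie below the real axis if that
  of \<open>zs\<close> is real.
\<close>

definition polygon_nbhd :: "complex list \<Rightarrow> real \<Rightarrow> complex list set" where
  "polygon_nbhd zs \<epsilon> = {ts. length ts = length zs \<and> ts ! 0 = 0 \<and> ts ! 1 = 1 \<and>
     (\<forall>i<length zs. cmod (ts ! i - zs ! i) < \<epsilon>)}"

text \<open>Edge \<open>i\<close> carries the letter \<open>lab i\<close> of the alphabet \<open>A\<close>; different edges, different letters.\<close>

definition edge_labeling :: "'a set \<Rightarrow> nat \<Rightarrow> (nat \<Rightarrow> 'a) \<Rightarrow> bool" where
  "edge_labeling A n lab \<longleftrightarrow> finite A \<and> lab ` {..<n} \<subseteq> A \<and> inj_on lab {..<n}"

text \<open>Reflection of the vector \<open>v\<close> in the line through the origin in direction \<open>d\<close>.\<close>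

definition reflect_in_line :: "complex \<Rightarrow> complex \<Rightarrow> complex" where
  "reflect_in_line d v = (2 * (v \<bullet> d) / (d \<bullet> d)) *\<^sub>R d - v"

text \<open>
  \<open>\<gamma>\<close> is a bi-infinite unit speed trajectory on the table bounded by \<open>zs\<close>. Its bounces happen
  at the times \<open>\<tau> k\<close>, on the edges \<open>e k\<close>, and \<open>v k\<close> is the velocity between the times \<open>\<tau> k\<close>
  and \<open>\<tau> (k + 1)\<close>. The limits of \<open>\<tau>\<close> say that the trajectory is defined for all times. It is
  nonsingular because it hits the boundary only at interior points of edges: strictly
  between bounces it stays in the open region enclosed by the polygon.
\<close>

definition nonsingular_trajectory ::
  "complex list \<Rightarrow> (real \<Rightarrow> complex) \<Rightarrow> (int \<Rightarrow> real) \<Rightarrow> (int \<Rightarrow> complex) \<Rightarrow> (int \<Rightarrow> nat) \<Rightarrow> bool" where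
  "nonsingular_trajectory zs \<gamma> \<tau> v e \<longleftrightarrow>
     strict_mono \<tau> \<and> filterlim \<tau> at_top at_top \<and> filterlim \<tau> at_bot at_bot \<and>
     (\<forall>k. e k < length zs \<and> \<gamma> (\<tau> k) \<in> edge_interior zs (e k)) \<and>
     (\<forall>k. cmod (v k) = 1) \<and>
     (\<forall>k. \<forall>t\<in>{\<tau> k..\<tau> (k + 1)}. \<gamma> t = \<gamma> (\<tau> k) + (t - \<tau> k) *\<^sub>R v k) \<and>
     (\<forall>k. \<forall>t\<in>{\<tau> k<..<\<tau> (k + 1)}. \<gamma> t \<in> inside (polygon_boundary zs)) \<and>
     (\<forall>k. v k = reflect_in_line (next_vertex zs (e k) - zs ! e k) (v (k - 1)))"

definition bounce_sequences :: "complex list \<Rightarrow> (nat \<Rightarrow> 'a) \<Rightarrow> (int \<Rightarrow> 'a) set" where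
  "bounce_sequences zs lab = {\<lambda>k. lab (e k) | e. \<exists>\<gamma> \<tau> v. nonsingular_trajectory zs \<gamma> \<tau> v e}"

definition bounce_language :: "complex list \<Rightarrow> (nat \<Rightarrow> 'a) \<Rightarrow> 'a list set" where
  "bounce_language zs lab =
     {map (\<lambda>j. b (k + int j)) [0..<m] | b k m. b \<in> bounce_sequences zs lab}"

end

theory Submission
  imports Defs
begin

text \<open>
  Start a given trajectory at a point \<open>x\<close> inside \<open>zs\<close>. On nearby polygons \<open>ts\<close> the point \<open>x\<close> is
  still inside, and an orbit from \<open>x\<close> in a nearby direction makes the same first bounces. Unfolding
  the reflections turns an orbit into a straight line, so that for each finite sequence of edges
  and each vertex at most one direction at \<open>x\<close> runs into that vertex; hence all but countably many
  directions at \<open>x\<close> extend to bi-infinite nonsingular trajectories on \<open>ts\<close>.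
\<close>

subsection \<open>Orbits of the billiard flow\<close>

text \<open>The given trajectory itself need not survive: on a changed table the same initial
  direction may run into a vertex later on, and a finite word counts only if it occurs in a
  trajectory that is nonsingular for all past and future times. So the direction has to move as
  well, and each nearby table gets its own.

  Three further points need work. The bounce times of a regular orbit must diverge, or it would not
  give a trajectory defined for all times. A fixed point must stay inside although the whole
  boundary moves; this is a homotopy argument. And edges that share a vertex must not meet elsewhere
  after the perturbation, which no distance estimate gives, since they touch already. What is shown
  for nearby tuples is \<open>simple_edges\<close>, so the flow is constructed under this condition,
  which is weaker than \<open>polygon\<close>.

  All limits are taken along sequences of tables. Compactness thus replaces explicit estimates, and
  \<epsilon> comes out of a contradiction.\<close>

abbreviation side :: "complex list \<Rightarrow> nat \<Rightarrow> complex" where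
  "side zs i \<equiv> next_vertex zs i - zs ! i"

text \<open>This is the part of simplicity that makes the reflection law unambiguous: a bounce point
  lies on exactly one edge.\<close>

definition simple_edges :: "complex list \<Rightarrow> bool" where
  "simple_edges zs \<longleftrightarrow>
     (\<forall>i<length zs. \<forall>j<length zs. i \<noteq> j \<longrightarrow> edge_interior zs i \<inter> edge zs j = {})"

section \<open>Algebra of reflections in a line\<close>

lemma reflect_in_line_minus: "reflect_in_line d (- v) = - reflect_in_line d v"
  by (simp add: reflect_in_line_def)

lemma reflect_in_line_add: "reflect_in_line d (v + w) = reflect_in_line d v + reflect_in_line d w"
  by (simp add: reflect_in_line_def inner_add_left add_divide_distrib distrib_left scaleR_add_left)

lemma reflect_in_line_scaleR: "reflect_in_line d (c *\<^sub>R v) = c *\<^sub>R reflect_in_line d v"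
  by (simp add: reflect_in_line_def algebra_simps)

lemma reflect_in_line_self: "reflect_in_line d d = d"
  by (cases "d = 0") (auto simp: reflect_in_line_def scaleR_2)

lemma reflect_in_line_inner_self: "reflect_in_line d v \<bullet> d = v \<bullet> d"
  by (cases "d = 0") (simp_all add: reflect_in_line_def inner_diff_left)

text \<open>\<open>\<i> * d\<close> is \<open>d\<close> turned by a right angle and serves as the
  normal of the line throughout: reflection keeps the tangential component and negates this
  one.\<close>

lemma reflect_in_line_inner_normal: "reflect_in_line d v \<bullet> (\<i> * d) = - (v \<bullet> (\<i> * d))"
proof -
  have "d \<bullet> (\<i> * d) = 0"
    by (simp add: inner_complex_def)
  then show ?thesis
    by (simp add: reflect_in_line_def inner_diff_left)
qed

lemma reflect_in_line_invol: "d \<noteq> 0 \<Longrightarrow> reflect_in_line d (reflect_in_line d v) = v"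
  using reflect_in_line_inner_self[of d v]
  by (simp add: reflect_in_line_def[of d "reflect_in_line d v"]) (simp add: reflect_in_line_def)

lemma norm_reflect_in_line: "d \<noteq> 0 \<Longrightarrow> cmod (reflect_in_line d v) = cmod v"
proof -
  assume "d \<noteq> 0"
  then have "reflect_in_line d v \<bullet> reflect_in_line d v = v \<bullet> v"
    by (simp add: reflect_in_line_def inner_diff_left inner_diff_right inner_commute[of d v])
  then show ?thesis
    by (simp add: norm_eq_sqrt_inner)
qed

lemma parallel_if_inner_normal_zero:
  fixes d v :: complex
  assumes "d \<noteq> 0" "v \<bullet> (\<i> * d) = 0"
  shows "\<exists>c. v = c *\<^sub>R d"
proof
  have *: "Im v * Re d = Re v * Im d"
    using assms(2) by (simp add: inner_complex_def)
  have "(d \<bullet> d) *\<^sub>R v = (v \<bullet> d) *\<^sub>R d"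
  proof (rule complex_eqI)
    show "Re ((d \<bullet> d) *\<^sub>R v) = Re ((v \<bullet> d) *\<^sub>R d)"
      using * by (simp add: inner_complex_def) algebra
    show "Im ((d \<bullet> d) *\<^sub>R v) = Im ((v \<bullet> d) *\<^sub>R d)"
      using * by (simp add: inner_complex_def) algebra
  qed
  moreover have "d \<bullet> d \<noteq> 0"
    using assms(1) by simp
  ultimately show "v = ((v \<bullet> d) / (d \<bullet> d)) *\<^sub>R d"
    by (metis divide_inverse inverse_eq_divide mult.commute scaleR_one scaleR_scaleR right_inverse)
qed

section \<open>Edges and the boundary\<close>

lemma mem_edge_iff:
  "x \<in> edge zs i \<longleftrightarrow> (\<exists>u. 0 \<le> u \<and> u \<le> 1 \<and> x = zs ! i + u *\<^sub>R side zs i)"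
  by (auto simp: edge_def in_segment algebra_simps)

lemma mem_edge_interior_iff:
  "x \<in> edge_interior zs i \<longleftrightarrow>
     side zs i \<noteq> 0 \<and> (\<exists>u. 0 < u \<and> u < 1 \<and> x = zs ! i + u *\<^sub>R side zs i)"
  by (auto simp: edge_interior_def in_segment algebra_simps)

lemma edge_interior_subset_edge: "edge_interior zs i \<subseteq> edge zs i"
  by (auto simp: edge_def edge_interior_def open_segment_def)

lemma closed_edge: "closed (edge zs i)"
  by (simp add: edge_def)

lemma compact_polygon_boundary: "compact (polygon_boundary zs)"
  unfolding polygon_boundary_def edge_def by auto

lemma closed_polygon_boundary: "closed (polygon_boundary zs)"
  by (simp add: compact_imp_closed compact_polygon_boundary)

lemma next_vertex_in_set: "i < length zs \<Longrightarrow> next_vertex zs i \<in> set zs"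
  unfolding next_vertex_def by (intro nth_mem) (auto intro: mod_less_divisor)

lemma polygon_boundary_cases:
  assumes "q \<in> polygon_boundary zs"
  obtains "q \<in> set zs" | i where "i < length zs" "q \<in> edge_interior zs i"
proof -
  obtain i where i: "i < length zs" "q \<in> edge zs i"
    using assms by (auto simp: polygon_boundary_def)
  show thesis
  proof (cases "q \<in> edge_interior zs i")
    case False
    then have "q = zs ! i \<or> q = next_vertex zs i"
      using i(2) by (auto simp: edge_def edge_interior_def open_segment_def)
    then show ?thesis
      using that(1) i(1) next_vertex_in_set by auto
  qed (use that(2) i(1) in auto)
qed

lemma edge_interior_shift:
  assumes "q \<in> edge_interior zs i"
  shows "\<exists>r>0. \<forall>t. \<bar>t\<bar> < r \<longrightarrow> q + t *\<^sub>R (c *\<^sub>R side zs i) \<in> edge zs i"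
proof -
  obtain u where u: "0 < u" "u < 1" "q = zs ! i + u *\<^sub>R side zs i"
    using assms by (auto simp: mem_edge_interior_iff)
  have "((\<lambda>t. u + t * c) \<longlongrightarrow> u + 0 * c) (nhds 0)"
    by (intro tendsto_intros) (simp add: filterlim_ident)
  then have "\<forall>\<^sub>F t in nhds 0. u + t * c \<in> {0<..<1}"
    by (rule topological_tendstoD) (use u in auto)
  then obtain r where r: "r > 0" "\<And>t. dist t 0 < r \<Longrightarrow> u + t * c \<in> {0<..<1}"
    by (auto simp: eventually_nhds_metric)
  have "q + t *\<^sub>R (c *\<^sub>R side zs i) \<in> edge zs i" if "\<bar>t\<bar> < r" for t
  proof -
    have "q + t *\<^sub>R (c *\<^sub>R side zs i) = zs ! i + (u + t * c) *\<^sub>R side zs i"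
      by (simp add: u(3) scaleR_add_left)
    then show ?thesis
      unfolding mem_edge_iff using r(2)[of t] that by (intro exI[of _ "u + t * c"]) auto
  qed
  then show ?thesis using r(1) by blast
qed

section \<open>Single flights between two bounces\<close>

text \<open>Time 0 is left out, so \<open>p\<close> may be a bounce point as well as a point inside
  the table.\<close>

definition flight :: "complex list \<Rightarrow> complex \<Rightarrow> complex \<Rightarrow> real \<Rightarrow> nat \<Rightarrow> bool" where
  "flight zs p v s e \<longleftrightarrow> 0 < s \<and> e < length zs \<and> p + s *\<^sub>R v \<in> edge_interior zs e \<and>
     (\<forall>t\<in>{0<..<s}. p + t *\<^sub>R v \<in> inside (polygon_boundary zs))"

lemma flight_side_nonzero: "flight zs p v s e \<Longrightarrow> side zs e \<noteq> 0"
  by (auto simp: flight_def mem_edge_interior_iff)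

lemma flight_avoids_edge:
  assumes "flight zs p v s e" "0 < t" "t < s" "i < length zs"
  shows "p + t *\<^sub>R v \<notin> edge zs i"
proof -
  have "p + t *\<^sub>R v \<in> inside (polygon_boundary zs)"
    using assms by (auto simp: flight_def)
  then have "p + t *\<^sub>R v \<notin> polygon_boundary zs"
    using inside_no_overlap by blast
  then show ?thesis
    using assms(4) by (auto simp: polygon_boundary_def)
qed

text \<open>A ray arriving parallel to the edge would already be on that edge shortly before its
  arrival, when it should still be inside.\<close>

lemma flight_not_parallel:
  assumes "flight zs p v s e"
  shows "v \<noteq> c *\<^sub>R side zs e"
proof
  assume v: "v = c *\<^sub>R side zs e"
  have s: "0 < s" "e < length zs" "p + s *\<^sub>R v \<in> edge_interior zs e"
    using assms by (auto simp: flight_def)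
  obtain r where r: "r > 0" "\<And>t. \<bar>t\<bar> < r \<Longrightarrow> p + s *\<^sub>R v + t *\<^sub>R (c *\<^sub>R side zs e) \<in> edge zs e"
    using edge_interior_shift[OF s(3)] by blast
  define t where "t = min (s / 2) (r / 2)"
  have t: "0 < t" "t < s" "t < r"
    using r(1) s(1) by (auto simp: t_def min_def)
  have "p + s *\<^sub>R v + (- t) *\<^sub>R v \<in> edge zs e"
    using r(2)[of "- t"] t unfolding v by simp
  then have "p + (s - t) *\<^sub>R v \<in> edge zs e"
    by (simp add: scaleR_left_diff_distrib add_diff_eq)
  then show False
    using flight_avoids_edge[OF assms, of "s - t" e] t s by auto
qed

lemma flight_transversal: "flight zs p v s e \<Longrightarrow> v \<bullet> (\<i> * side zs e) \<noteq> 0"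
  using parallel_if_inner_normal_zero flight_not_parallel flight_side_nonzero by metis

lemma edge_interior_isolated:
  assumes "simple_edges zs" "e < length zs" "q \<in> edge_interior zs e"
  shows "\<exists>r>0. ball q r \<inter> polygon_boundary zs \<subseteq> edge zs e"
proof -
  define C where "C = (\<Union>j\<in>{..<length zs} - {e}. edge zs j)"
  have "closed C"
    unfolding C_def by (intro closed_UN) (auto simp: closed_edge)
  moreover have "q \<notin> C"
    using assms by (auto simp: C_def simple_edges_def)
  ultimately obtain r where r: "r > 0" "ball q r \<subseteq> - C"
    by (metis ComplI open_Compl openE)
  have "ball q r \<inter> polygon_boundary zs \<subseteq> edge zs e"
    using r(2) by (auto simp: C_def polygon_boundary_def)
  then show ?thesis using r(1) by blast
qed

lemma inside_connected:
  assumes "connected H" "x \<in> H" "y \<in> H" "H \<inter> S = {}" "x \<in> inside S"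
  shows "y \<in> inside S"
proof (rule inside_same_component[OF _ assms(5)])
  show "connected_component (- S) x y"
    unfolding connected_component_def using assms by (intro exI[of _ H]) auto
qed

text \<open>The boundary cuts a small disc around a bounce point into two half discs. The incoming ray
  and the reflected ray lie in the same one, so no global separation property is needed.\<close>

lemma reflected_ray_enters_inside:
  assumes "simple_edges zs" "flight zs p v s e" "cmod v = 1"
  shows "\<exists>\<delta>>0. \<forall>t\<in>{0<..<\<delta>}.
    p + s *\<^sub>R v + t *\<^sub>R reflect_in_line (side zs e) v \<in> inside (polygon_boundary zs)"
proof -
  define q where "q = p + s *\<^sub>R v"
  define d where "d = side zs e"
  define w where "w = reflect_in_line d v"
  define c where "c = v \<bullet> (\<i> * d)"
  have fl: "0 < s" "e < length zs" "q \<in> edge_interior zs e"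
    "\<And>t. 0 < t \<Longrightarrow> t < s \<Longrightarrow> p + t *\<^sub>R v \<in> inside (polygon_boundary zs)"
    using assms(2) by (auto simp: flight_def q_def)
  have c: "c \<noteq> 0"
    using flight_transversal[OF assms(2)] by (simp add: c_def d_def)
  have w: "w \<bullet> (\<i> * d) = - c" "cmod w = 1"
    using reflect_in_line_inner_normal norm_reflect_in_line flight_side_nonzero[OF assms(2)] assms(3)
    by (auto simp: w_def c_def d_def)
  obtain r where r: "r > 0" "ball q r \<inter> polygon_boundary zs \<subseteq> edge zs e"
    using edge_interior_isolated[OF assms(1) fl(2,3)] by blast
  \<comment> \<open>The open half disc on the incoming side. The factor \<open>c\<close> spares a
    case split on the side: the normal components of the incoming offset \<open>- t v\<close> and of
    the reflected offset \<open>t w\<close>, multiplied by \<open>c\<close>, are both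
    \<open>- t c^2\<close>.\<close>
  define H where "H = ball q r \<inter> {z. (c *\<^sub>R (\<i> * d)) \<bullet> z < (c *\<^sub>R (\<i> * d)) \<bullet> q}"
  have H: "z \<in> H \<longleftrightarrow> dist q z < r \<and> c * ((z - q) \<bullet> (\<i> * d)) < 0" for z
  proof -
    have "(c *\<^sub>R (\<i> * d)) \<bullet> z < (c *\<^sub>R (\<i> * d)) \<bullet> q \<longleftrightarrow> c * ((z - q) \<bullet> (\<i> * d)) < 0"
      by (simp add: inner_diff_left inner_commute[of "\<i> * d"] right_diff_distrib)
    then show ?thesis by (simp add: H_def)
  qed
  have conn: "connected H"
    unfolding H_def by (intro convex_connected convex_Int convex_ball convex_halfspace_lt)
  have "H \<inter> edge zs e = {}"
  proof -
    have "(z - q) \<bullet> (\<i> * d) = 0" if z: "z \<in> edge zs e" for z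
    proof -
      obtain a where "z = zs ! e + a *\<^sub>R d"
        using z unfolding mem_edge_iff d_def by blast
      moreover obtain b where "q = zs ! e + b *\<^sub>R d"
        using fl(3) unfolding mem_edge_interior_iff d_def by blast
      ultimately have "z - q = (a - b) *\<^sub>R d"
        by (simp add: scaleR_left_diff_distrib)
      then show ?thesis by (simp add: inner_complex_def)
    qed
    then show ?thesis by (auto simp: H)
  qed
  then have disj: "H \<inter> polygon_boundary zs = {}"
    using r(2) by (auto simp: H_def)
  define t0 where "t0 = min (s / 2) (r / 2)"
  have t0: "0 < t0" "t0 < s" "t0 < r"
    using r(1) fl(1) by (auto simp: t0_def min_def)
  have eq: "p + (s - t0) *\<^sub>R v - q = (- t0) *\<^sub>R v"
    by (simp add: q_def scaleR_left_diff_distrib)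
  have cc: "c * c > 0"
    using c by (simp add: zero_less_mult_iff linorder_neq_iff) linarith
  have x: "p + (s - t0) *\<^sub>R v \<in> H"
  proof -
    have "dist q (p + (s - t0) *\<^sub>R v) = t0"
      using assms(3) t0 by (simp add: dist_norm norm_minus_commute[of q] eq)
    moreover have "c * ((p + (s - t0) *\<^sub>R v - q) \<bullet> (\<i> * d)) = - (t0 * (c * c))"
      unfolding eq by (simp add: c_def)
    ultimately show ?thesis
      unfolding H using t0 cc by simp
  qed
  have "q + t *\<^sub>R w \<in> inside (polygon_boundary zs)" if t: "0 < t" "t < r" for t
  proof (rule inside_connected[OF conn x _ disj])
    have "c * ((q + t *\<^sub>R w - q) \<bullet> (\<i> * d)) = - (t * (c * c))"
      using w(1) by simp
    then show "q + t *\<^sub>R w \<in> H"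
      unfolding H using t cc w(2) by (simp add: dist_norm)
    show "p + (s - t0) *\<^sub>R v \<in> inside (polygon_boundary zs)"
      using fl(4) t0 by simp
  qed
  then show ?thesis
    using r(1) unfolding q_def w_def d_def by (intro exI[of _ r]) auto
qed

text \<open>The first exit time is an infimum, taken over a set that is closed because the inside is
  open and nonempty because the inside is bounded. The exit point is a limit of inside points but
  not inside, hence on the frontier of the inside.\<close>

lemma ray_hits_boundary:
  assumes "cmod v = 1" "\<delta> > 0" "\<forall>t\<in>{0<..<\<delta>}. p + t *\<^sub>R v \<in> inside (polygon_boundary zs)"
  obtains s where "s > 0" "p + s *\<^sub>R v \<in> polygon_boundary zs"
    "\<forall>t\<in>{0<..<s}. p + t *\<^sub>R v \<in> inside (polygon_boundary zs)"
proof -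
  let ?I = "inside (polygon_boundary zs)"
  \<comment> \<open>Starting at \<open>\<delta> / 2\<close> keeps the infimum positive even if
    \<open>p\<close> is a bounce point, which is itself not inside.\<close>
  define K where "K = {t. \<delta> / 2 \<le> t} \<inter> (\<lambda>t. p + t *\<^sub>R v) -` (- ?I)"
  have "closed K"
    unfolding K_def
    by (intro closed_Int closed_vimage continuous_intros closed_Compl open_inside
        closed_polygon_boundary closed_Collect_le)
  obtain B where B: "\<And>x. x \<in> ?I \<Longrightarrow> cmod x \<le> B"
    using bounded_inside[OF compact_imp_bounded[OF compact_polygon_boundary]]
    by (metis bounded_iff)
  \<comment> \<open>By this time a unit speed ray has left the ball of radius \<open>B\<close> that
    contains the inside.\<close>
  define t1 where "t1 = max (\<delta> / 2) (\<bar>B\<bar> + cmod p + 1)"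
  have "cmod (t1 *\<^sub>R v) \<le> cmod (p + t1 *\<^sub>R v) + cmod p"
    by (metis add.commute add_diff_cancel_left' norm_triangle_ineq4)
  then have "cmod (p + t1 *\<^sub>R v) > B"
    using assms(1) by (simp add: t1_def max_def split: if_splits)
  moreover have "\<delta> / 2 \<le> t1"
    by (simp add: t1_def)
  ultimately have "t1 \<in> K"
    using B[of "p + t1 *\<^sub>R v"] by (auto simp: K_def)
  define s where "s = Inf K"
  have bdd: "bdd_below K"
    by (auto simp: K_def intro!: bdd_belowI[of _ "\<delta> / 2"])
  have sK: "s \<in> K"
    unfolding s_def using \<open>closed K\<close> bdd \<open>t1 \<in> K\<close> by (intro closed_contains_Inf) auto
  then have s: "s > 0" "p + s *\<^sub>R v \<notin> ?I"
    using assms(2) by (auto simp: K_def)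
  have in_I: "p + t *\<^sub>R v \<in> ?I" if "0 < t" "t < s" for t
  proof (cases "t < \<delta>")
    case False
    have "t \<notin> K"
      using that(2) cInf_lower[OF _ bdd, of t] by (auto simp: s_def)
    then show ?thesis using False assms(2) by (auto simp: K_def)
  qed (use assms(3) that in auto)
  have "p + s *\<^sub>R v \<in> closure ?I"
  proof (rule closure_sequential[THEN iffD2], intro exI conjI allI)
    let ?x = "\<lambda>n. p + (s - s / 2 * inverse (real (Suc n))) *\<^sub>R v"
    show "?x n \<in> ?I" for n
    proof (rule in_I)
      have "s / 2 * inverse (real (Suc n)) \<le> s / 2 * 1"
        using s(1) by (intro mult_left_mono) (auto simp: field_simps)
      then show "0 < s - s / 2 * inverse (real (Suc n))"
        using s(1) by simp
      show "s - s / 2 * inverse (real (Suc n)) < s"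
        using s(1) by simp
    qed
    have "?x \<longlonglongrightarrow> p + (s - s / 2 * 0) *\<^sub>R v"
      by (intro tendsto_intros LIMSEQ_inverse_real_of_nat)
    then show "?x \<longlonglongrightarrow> p + s *\<^sub>R v" by simp
  qed
  then have "p + s *\<^sub>R v \<in> frontier ?I"
    using s(2) by (simp add: frontier_def interior_open open_inside closed_polygon_boundary)
  then have "p + s *\<^sub>R v \<in> polygon_boundary zs"
    using frontier_inside_subset[OF closed_polygon_boundary] by blast
  then show thesis
    using that s(1) in_I by auto
qed

section \<open>Unfolding and the existence of forward orbits\<close>

text \<open>For a nondegenerate edge this is the reflection of the plane in the line that carries
  the edge.\<close>

definition mirror :: "complex list \<Rightarrow> nat \<Rightarrow> complex \<Rightarrow> complex" where
  "mirror zs e z = zs ! e + reflect_in_line (side zs e) (z - zs ! e)"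

text \<open>One step of unfolding: the outgoing ray is carried to the straight continuation of the
  incoming one.\<close>

lemma mirror_reflected_ray:
  assumes "q \<in> edge_interior zs e"
  shows "mirror zs e (q + t *\<^sub>R reflect_in_line (side zs e) v) = q + t *\<^sub>R v"
proof -
  obtain u where u: "q = zs ! e + u *\<^sub>R side zs e" and d: "side zs e \<noteq> 0"
    using assms by (auto simp: mem_edge_interior_iff)
  have "q + t *\<^sub>R reflect_in_line (side zs e) v - zs ! e
      = u *\<^sub>R side zs e + t *\<^sub>R reflect_in_line (side zs e) v"
    by (simp add: u)
  moreover have "reflect_in_line d (u *\<^sub>R d + t *\<^sub>R reflect_in_line d v) = u *\<^sub>R d + t *\<^sub>R v"
    if "d \<noteq> 0" for d
    using that
    by (simp add: reflect_in_line_add reflect_in_line_scaleR reflect_in_line_self reflect_in_line_invol)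
  ultimately show ?thesis
    unfolding mirror_def using u d by (metis add.assoc)
qed

text \<open>The directions of the rays from \<open>x\<close> that, after unfolding along the edges \<open>es\<close>,
  run into a vertex.\<close>

definition singular_directions :: "complex list \<Rightarrow> complex \<Rightarrow> complex set" where
  "singular_directions zs x = (\<lambda>(es, w). sgn (foldr (mirror zs) es w - x)) ` (UNIV \<times> set zs)"

lemma countable_singular_directions: "countable (singular_directions zs x)"
  unfolding singular_directions_def by (intro countable_image countable_SIGMA) (auto intro: countable_finite)

text \<open>Edge \<open>e k\<close> is hit at the end of flight \<open>k\<close>, in the point
  \<open>p (Suc k)\<close>; the starting point \<open>p 0\<close> is not tied to any edge.\<close>

definition orbit ::
  "complex list \<Rightarrow> (nat \<Rightarrow> complex) \<Rightarrow> (nat \<Rightarrow> complex) \<Rightarrow> (nat \<Rightarrow> real) \<Rightarrow> (nat \<Rightarrow> nat) \<Rightarrow> bool" where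
  "orbit zs p v s e \<longleftrightarrow> (\<forall>k. cmod (v k) = 1 \<and> flight zs (p k) (v k) (s k) (e k) \<and>
     p (Suc k) = p k + s k *\<^sub>R v k \<and> v (Suc k) = reflect_in_line (side zs (e k)) (v k))"

text \<open>By \<open>unf\<close> the current flight unfolds to the ray from \<open>x\<close> in
  direction \<theta>, with \<open>T\<close> the time elapsed so far. If the flight ended in a
  vertex, the unfolded vertex would lie on that ray at positive distance from \<open>x\<close>, and
  \<theta> would be singular.\<close>

lemma nonsingular_flight_exists:
  assumes "cmod v = 1" "\<theta> \<notin> singular_directions zs x" "cmod \<theta> = 1" "T \<ge> 0"
    and unf: "\<And>t. x + (T + t) *\<^sub>R \<theta> = foldr (mirror zs) es (p + t *\<^sub>R v)"
    and "\<exists>\<delta>>0. \<forall>t\<in>{0<..<\<delta>}. p + t *\<^sub>R v \<in> inside (polygon_boundary zs)"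
  shows "\<exists>s e. flight zs p v s e"
proof -
  obtain s where s: "s > 0" "p + s *\<^sub>R v \<in> polygon_boundary zs"
    "\<forall>t\<in>{0<..<s}. p + t *\<^sub>R v \<in> inside (polygon_boundary zs)"
    using ray_hits_boundary[OF assms(1)] assms(6) by metis
  from s(2) show ?thesis
  proof (cases rule: polygon_boundary_cases)
    case 1
    have "foldr (mirror zs) es (p + s *\<^sub>R v) - x = (T + s) *\<^sub>R \<theta>"
      unfolding unf[symmetric] by simp
    then have "\<theta> = sgn (foldr (mirror zs) es (p + s *\<^sub>R v) - x)"
      using assms(3,4) s(1) by (simp add: sgn_scaleR) (simp add: sgn_div_norm)
    then have "\<theta> \<in> singular_directions zs x"
      unfolding singular_directions_def using 1 by force
    then show ?thesis using assms(2) by simp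
  next
    case (2 i)
    then show ?thesis
      using s by (auto simp: flight_def)
  qed
qed

lemma orbit_exists:
  assumes "simple_edges zs" "x \<in> inside (polygon_boundary zs)" "cmod \<theta> = 1"
    "\<theta> \<notin> singular_directions zs x"
  obtains p v s e where "orbit zs p v s e" "p 0 = x" "v 0 = \<theta>"
proof -
  \<comment> \<open>Elapsed time and unfolding are quantified inside the invariant, so the state
    built by dependent choice consists of the flight data alone.\<close>
  define Inv where "Inv = (\<lambda>n (p, v, s, e). (n = (0::nat) \<longrightarrow> p = x \<and> v = \<theta>) \<and> cmod v = 1 \<and>
    flight zs p v s e \<and> (\<exists>T\<ge>0. \<exists>es. \<forall>t. x + (T + t) *\<^sub>R \<theta> = foldr (mirror zs) es (p + t *\<^sub>R v)))"
  define Stp where "Stp = (\<lambda>(n::nat) (p, v, s, e) (p', v', s'::real, e'::nat).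
    p' = p + s *\<^sub>R v \<and> v' = reflect_in_line (side zs e) v)"
  have "\<exists>f. \<forall>n. Inv n (f n) \<and> Stp n (f n) (f (Suc n))"
  proof (rule dependent_nat_choice)
    have "open (inside (polygon_boundary zs))"
      by (simp add: open_inside closed_polygon_boundary)
    then obtain \<delta> where \<delta>: "\<delta> > 0" "ball x \<delta> \<subseteq> inside (polygon_boundary zs)"
      using assms(2) by (meson openE)
    have "\<exists>\<delta>>0. \<forall>t\<in>{0<..<\<delta>}. x + t *\<^sub>R \<theta> \<in> inside (polygon_boundary zs)"
      using \<delta> assms(3) by (intro exI[of _ \<delta>]) (auto intro!: subsetD[OF \<delta>(2)] simp: dist_norm)
    then obtain s e where "flight zs x \<theta> s e"
      using nonsingular_flight_exists[of \<theta> \<theta> zs x 0 "[]" x] assms by auto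
    then have "Inv 0 (x, \<theta>, s, e)"
      unfolding Inv_def using assms(3) by (auto intro!: exI[of _ 0] exI[of _ "[]"])
    then show "\<exists>st. Inv 0 st" by blast
  next
    fix st n assume "Inv n st"
    then obtain p v s e T es where st: "st = (p, v, s, e)" "cmod v = 1" "flight zs p v s e" "T \<ge> 0"
      and unf: "\<And>t. x + (T + t) *\<^sub>R \<theta> = foldr (mirror zs) es (p + t *\<^sub>R v)"
      by (auto simp: Inv_def split: prod.splits)
    define q where "q = p + s *\<^sub>R v"
    define w where "w = reflect_in_line (side zs e) v"
    have s: "s > 0" "q \<in> edge_interior zs e"
      using st(3) by (auto simp: flight_def q_def)
    have w: "cmod w = 1"
      using st(2) norm_reflect_in_line[OF flight_side_nonzero[OF st(3)]] by (simp add: w_def)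
    \<comment> \<open>The newest edge goes to the end of the list, since \<open>foldr\<close>
      applies the last mirror first.\<close>
    have unf': "x + (T + s + t) *\<^sub>R \<theta> = foldr (mirror zs) (es @ [e]) (q + t *\<^sub>R w)" for t
      using unf[of "s + t"] mirror_reflected_ray[OF s(2), of t v]
      by (simp add: w_def) (simp add: q_def algebra_simps)
    obtain s' e' where fl': "flight zs q w s' e'"
      using nonsingular_flight_exists[OF w assms(4,3) _ unf']
        reflected_ray_enters_inside[OF assms(1) st(3,2)] st(4) s(1)
      unfolding q_def w_def by auto
    have "\<exists>T\<ge>0. \<exists>es. \<forall>t. x + (T + t) *\<^sub>R \<theta> = foldr (mirror zs) es (q + t *\<^sub>R w)"
      using unf' st(4) s(1) by (intro exI[of _ "T + s"] conjI exI[of _ "es @ [e]"] allI) auto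
    then have "Inv (Suc n) (q, w, s', e')"
      using fl' w by (simp add: Inv_def)
    moreover have "Stp n st (q, w, s', e')"
      by (simp add: Stp_def st(1) q_def w_def)
    ultimately show "\<exists>st'. Inv (Suc n) st' \<and> Stp n st st'"
      by blast
  qed
  then obtain f where f: "\<And>n. Inv n (f n)" "\<And>n. Stp n (f n) (f (Suc n))"
    by blast
  define p where "p = (\<lambda>n. fst (f n))"
  define v where "v = (\<lambda>n. fst (snd (f n)))"
  define s where "s = (\<lambda>n. fst (snd (snd (f n))))"
  define e where "e = (\<lambda>n. snd (snd (snd (f n))))"
  have feq: "f n = (p n, v n, s n, e n)" for n
    by (simp add: p_def v_def s_def e_def)
  have "orbit zs p v s e"
    using f unfolding orbit_def feq Inv_def Stp_def by auto
  moreover have "p 0 = x" "v 0 = \<theta>"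
    using f(1)[of 0] unfolding feq Inv_def by auto
  ultimately show thesis
    using that by blast
qed

subsection \<open>Bi-infinite trajectories\<close>

lemma inner_pythagoras:
  fixes d v :: complex
  shows "(v \<bullet> d)\<^sup>2 + (v \<bullet> (\<i> * d))\<^sup>2 = (v \<bullet> v) * (d \<bullet> d)"
  by (simp add: inner_complex_def power2_eq_square algebra_simps)

text \<open>If the bounce points accumulated at \<open>L\<close>, then eventually only edges through \<open>L\<close> would be
  hit. Reflections in lines through \<open>L\<close> preserve the distance from \<open>L\<close> to the line of motion; it
  would have to vanish, so that the trajectory would run along the edge it leaves.\<close>

lemma orbit_times_at_top:
  assumes "orbit zs p v s e"
  shows "filterlim (\<lambda>n. \<Sum>i<n. s i) at_top sequentially"
proof (rule ccontr)
  have o: "\<And>k. cmod (v k) = 1" "\<And>k. flight zs (p k) (v k) (s k) (e k)"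
    "\<And>k. p (Suc k) = p k + s k *\<^sub>R v k" "\<And>k. v (Suc k) = reflect_in_line (side zs (e k)) (v k)"
    using assms by (auto simp: orbit_def)
  have pos: "s k > 0" and elen: "e k < length zs" for k
    using o(2) by (auto simp: flight_def)
  have edge_hit: "p (Suc k) \<in> edge zs (e k)" for k
    using o(2)[of k] edge_interior_subset_edge unfolding o(3) flight_def by blast
  assume "\<not> filterlim (\<lambda>n. \<Sum>i<n. s i) at_top sequentially"
  then obtain Z where Z: "\<not> (\<forall>\<^sub>F n in sequentially. Z \<le> (\<Sum>i<n. s i))"
    unfolding filterlim_at_top by blast
  have bnd: "(\<Sum>i\<le>n. s i) \<le> Z" for n
  proof (rule ccontr)
    assume n: "\<not> (\<Sum>i\<le>n. s i) \<le> Z"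
    have "Z \<le> (\<Sum>i<m. s i)" if "m \<ge> Suc n" for m
    proof -
      have "(\<Sum>i\<le>n. s i) \<le> (\<Sum>i<m. s i)"
        using that pos by (intro sum_mono2) (auto intro: less_imp_le)
      then show ?thesis using n by simp
    qed
    then show False
      using Z unfolding eventually_sequentially by blast
  qed
  have "summable s"
    by (rule bounded_imp_summable[OF _ bnd]) (use pos in \<open>auto intro: less_imp_le\<close>)
  moreover have "norm (p (Suc k) - p k) = s k" for k
    using o(1)[of k] pos[of k] by (simp add: o(3))
  ultimately have "summable (\<lambda>k. norm (p (Suc k) - p k))"
    by simp
  then have "summable (\<lambda>k. p (Suc k) - p k)"
    by (rule summable_norm_cancel)
  then obtain M where "(\<lambda>n. \<Sum>k<n. p (Suc k) - p k) \<longlonglongrightarrow> M"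
    by (auto simp: summable_def sums_def)
  then have "(\<lambda>n. (p n - p 0) + p 0) \<longlonglongrightarrow> M + p 0"
    unfolding sum_lessThan_telescope by (intro tendsto_intros)
  then obtain L where L: "p \<longlonglongrightarrow> L"
    by auto
  have "\<forall>\<^sub>F k in sequentially. \<forall>j\<in>{j. j < length zs \<and> L \<notin> edge zs j}. p (Suc k) \<notin> edge zs j"
  proof (rule eventually_ball_finite)
    show "\<forall>j\<in>{j. j < length zs \<and> L \<notin> edge zs j}. \<forall>\<^sub>F k in sequentially. p (Suc k) \<notin> edge zs j"
    proof
      fix j assume j: "j \<in> {j. j < length zs \<and> L \<notin> edge zs j}"
      have "\<forall>\<^sub>F k in sequentially. p (Suc k) \<in> - edge zs j"
        by (rule topological_tendstoD[OF LIMSEQ_Suc[OF L]]) (use j closed_edge in auto)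
      then show "\<forall>\<^sub>F k in sequentially. p (Suc k) \<notin> edge zs j" by simp
    qed
  qed auto
  then obtain K where K: "\<And>k. k \<ge> K \<Longrightarrow> L \<in> edge zs (e k)"
    using edge_hit elen unfolding eventually_sequentially by blast
  \<comment> \<open>\<open>r k\<close> is the squared distance of the bounce point from
    \<open>L\<close> and \<open>a k\<close> its component along the unit velocity, so
    \<open>r k - (a k)^2\<close> is the squared distance from \<open>L\<close> to the line of
    motion.\<close>
  define r where "r = (\<lambda>k. (p k - L) \<bullet> (p k - L))"
  define a where "a = (\<lambda>k. (p k - L) \<bullet> v k)"
  have on_edge: "\<exists>c. p (Suc k) - L = c *\<^sub>R side zs (e k)" if k: "k \<ge> K" for k
  proof -
    obtain x where x: "p (Suc k) = zs ! e k + x *\<^sub>R side zs (e k)"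
      using edge_hit[of k] unfolding mem_edge_iff by blast
    obtain y where y: "L = zs ! e k + y *\<^sub>R side zs (e k)"
      using K[OF k] unfolding mem_edge_iff by blast
    have "p (Suc k) - L = (x - y) *\<^sub>R side zs (e k)"
      unfolding x by (subst y) (simp add: scaleR_left_diff_distrib)
    then show ?thesis by blast
  qed
  have r_Suc: "r (Suc k) = r k + 2 * s k * a k + (s k)\<^sup>2" for k
  proof -
    have "v k \<bullet> v k = 1"
      using o(1)[of k] by (simp add: dot_square_norm)
    moreover have "p (Suc k) - L = (p k - L) + s k *\<^sub>R v k"
      by (simp add: o(3))
    ultimately show ?thesis
      by (simp only: r_def a_def) (simp add: inner_add_left inner_add_right inner_commute[of "v k" "p k - L"]
          power2_eq_square distrib_left)
  qed
  \<comment> \<open>The bounce point and \<open>L\<close> are on the same edge, so their difference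
    is tangential and its product with the velocity survives the reflection. Hence \<open>a\<close>
    grows as in free motion.\<close>
  have a_Suc: "a (Suc k) = a k + s k" if k: "k \<ge> K" for k
  proof -
    obtain c where c: "p (Suc k) - L = c *\<^sub>R side zs (e k)"
      using on_edge[OF k] by blast
    have "a (Suc k) = (p (Suc k) - L) \<bullet> v k"
      unfolding a_def c o(4)
      using reflect_in_line_inner_self[of "side zs (e k)" "v k"]
      by (simp only: inner_scaleR_left inner_commute[of "side zs (e k)" "v k"]
          inner_commute[of "side zs (e k)" "reflect_in_line (side zs (e k)) (v k)"])
    also have "\<dots> = (p k - L) \<bullet> v k + s k * (v k \<bullet> v k)"
      unfolding o(3) by (simp add: inner_add_left inner_diff_left)
    also have "v k \<bullet> v k = 1"
      using o(1)[of k] by (simp add: dot_square_norm)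
    finally show ?thesis by (simp add: a_def)
  qed
  have inv: "r k - (a k)\<^sup>2 = r K - (a K)\<^sup>2" if "k \<ge> K" for k
    using that
  proof (induction k rule: nat_induct_at_least)
    case (Suc k)
    then show ?case
      by (simp add: r_Suc a_Suc power2_eq_square algebra_simps)
  qed simp
  have r0: "r \<longlonglongrightarrow> 0"
  proof -
    have "r \<longlonglongrightarrow> (L - L) \<bullet> (L - L)"
      unfolding r_def by (intro tendsto_intros L)
    then show ?thesis by simp
  qed
  have a0: "a \<longlonglongrightarrow> 0"
  proof (rule Lim_null_comparison)
    show "\<forall>\<^sub>F k in sequentially. norm (a k) \<le> cmod (p k - L)"
    proof (intro always_eventually allI)
      fix k
      show "norm (a k) \<le> cmod (p k - L)"
        using Cauchy_Schwarz_ineq2[of "p k - L" "v k"] o(1)[of k] by (simp add: a_def)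
    qed
    show "(\<lambda>k. cmod (p k - L)) \<longlonglongrightarrow> 0"
      using L by (simp add: LIM_zero_iff tendsto_norm_zero_iff)
  qed
  have inv0: "r (Suc K) = (a (Suc K))\<^sup>2"
  proof -
    have "(\<lambda>k. r k - (a k)\<^sup>2) \<longlonglongrightarrow> 0 - 0\<^sup>2"
      by (intro tendsto_intros r0 a0)
    moreover have "(\<lambda>k. r k - (a k)\<^sup>2) \<longlonglongrightarrow> r K - (a K)\<^sup>2"
      by (intro tendsto_eventually eventually_sequentiallyI[of K] inv)
    ultimately have "r K - (a K)\<^sup>2 = 0 - 0\<^sup>2"
      by (rule LIMSEQ_unique[symmetric])
    then show ?thesis using inv[of "Suc K"] by simp
  qed
  \<comment> \<open>Otherwise all later values of \<open>a\<close> would be at least the positive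
    flight time \<open>s (Suc K)\<close>, against \<open>a\<close> tending to 0. This also ensures
    that the bounce point differs from \<open>L\<close>.\<close>
  have "a (Suc K) \<noteq> 0"
  proof
    assume 0: "a (Suc K) = 0"
    have "a k \<ge> s (Suc K)" if "k \<ge> Suc (Suc K)" for k
      using that
    proof (induction k rule: nat_induct_at_least)
      case base
      then show ?case using a_Suc[of "Suc K"] 0 by simp
    next
      case (Suc k)
      then show ?case using a_Suc[of k] pos[of k] by simp
    qed
    then have "s (Suc K) \<le> 0"
      by (intro LIMSEQ_le_const[OF a0]) blast
    then show False using pos[of "Suc K"] by simp
  qed
  moreover obtain c where c: "p (Suc K) - L = c *\<^sub>R side zs (e K)"
    using on_edge by blast
  ultimately have "c \<noteq> 0"
    by (auto simp: a_def)
  define d where "d = side zs (e K)"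
  define w where "w = v (Suc K)"
  \<comment> \<open>The equality case of Cauchy-Schwarz: the unit vector \<open>w\<close> has no
    component normal to the edge, so neither has the velocity before the bounce, contradicting
    transversality.\<close>
  have "c\<^sup>2 * (d \<bullet> d) = c\<^sup>2 * (w \<bullet> d)\<^sup>2"
    using inv0 unfolding r_def a_def c d_def[symmetric] w_def[symmetric]
    by (simp add: power2_eq_square inner_commute[of d w] mult.assoc mult.left_commute)
  then have "(w \<bullet> d)\<^sup>2 = d \<bullet> d"
    using \<open>c \<noteq> 0\<close> by simp
  moreover have "w \<bullet> w = 1"
    using o(1)[of "Suc K"] by (simp add: dot_square_norm w_def)
  ultimately have "w \<bullet> (\<i> * d) = 0"
    using inner_pythagoras[of w d] by simp
  then have "v K \<bullet> (\<i> * d) = 0"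
    using reflect_in_line_inner_normal[of d "v K"] by (simp add: w_def d_def o(4))
  then show False
    using flight_transversal[OF o(2)[of K]] by (simp add: d_def)
qed

text \<open>The second orbit is run backwards in time. As the common starting point is inside and
  the initial velocities are opposite, the two first flights merge into a single flight through that
  point at time 0.\<close>

lemma glue_orbits:
  assumes o: "orbit zs p v s e" and o': "orbit zs p' v' s' e'"
    and start: "p' 0 = p 0" "v' 0 = - v 0" "p 0 \<in> inside (polygon_boundary zs)"
  shows "\<exists>\<gamma> \<tau> w E. nonsingular_trajectory zs \<gamma> \<tau> w E \<and> (\<forall>n. E (int n) = e n)"
proof -
  let ?I = "inside (polygon_boundary zs)"
  define T where "T = (\<lambda>n. \<Sum>i<n. s i)"
  define T' where "T' = (\<lambda>n. \<Sum>i<n. s' i)"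
  \<comment> \<open>Index 0 is the first forward bounce and index -1 the first backward one, so
    \<open>w (- 1)\<close> is the velocity of the flight through the starting point. Velocities of
    the second orbit change sign.\<close>
  define \<tau> where "\<tau> = (\<lambda>k::int. if 0 \<le> k then T (nat (k + 1)) else - T' (nat (- k)))"
  define X where "X = (\<lambda>k::int. if 0 \<le> k then p (nat (k + 1)) else p' (nat (- k)))"
  define w where "w = (\<lambda>k::int. if 0 \<le> k then v (nat (k + 1)) else - v' (nat (- 1 - k)))"
  define E where "E = (\<lambda>k::int. if 0 \<le> k then e (nat k) else e' (nat (- 1 - k)))"
  have pos_simps: "\<tau> (int n) = T (Suc n)" "X (int n) = p (Suc n)" "w (int n) = v (Suc n)"
    "E (int n) = e n" for n
    by (simp_all add: \<tau>_def X_def w_def E_def nat_add_distrib)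
  have neg_simps: "\<tau> (- 1 - int n) = - T' (Suc n)" "X (- 1 - int n) = p' (Suc n)"
    "w (- 1 - int n) = - v' n" "E (- 1 - int n) = e' n" for n
    by (simp_all add: \<tau>_def X_def w_def E_def nat_add_distrib)
  have orb: "cmod (v k) = 1" "0 < s k" "e k < length zs" "p (Suc k) \<in> edge_interior zs (e k)"
    "\<And>t. 0 < t \<Longrightarrow> t < s k \<Longrightarrow> p k + t *\<^sub>R v k \<in> ?I" "p (Suc k) = p k + s k *\<^sub>R v k"
    "v (Suc k) = reflect_in_line (side zs (e k)) (v k)" "T (Suc k) = T k + s k" for k
    using o by (auto simp: orbit_def flight_def T_def)
  have orb': "cmod (v' k) = 1" "0 < s' k" "e' k < length zs" "p' (Suc k) \<in> edge_interior zs (e' k)"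
    "\<And>t. 0 < t \<Longrightarrow> t < s' k \<Longrightarrow> p' k + t *\<^sub>R v' k \<in> ?I" "p' (Suc k) = p' k + s' k *\<^sub>R v' k"
    "v' (Suc k) = reflect_in_line (side zs (e' k)) (v' k)" "T' (Suc k) = T' k + s' k" for k
    using o' by (auto simp: orbit_def flight_def T'_def)
  have T0: "T 0 = 0" "T' 0 = 0"
    by (simp_all add: T_def T'_def)
  have nonneg_or_neg: "(\<exists>n. k = int n) \<or> (\<exists>n. k = - 1 - int n)" for k
    by (cases k rule: int_cases) (auto intro: exI[of _ "nat (- 1 - k)"])
  have step_cases: "(\<exists>n. k = int n \<and> k + 1 = int (Suc n)) \<or> (k = - 1 - int 0 \<and> k + 1 = int 0) \<or>
      (\<exists>n. k = - 1 - int (Suc n) \<and> k + 1 = - 1 - int n)" for k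
  proof (cases "k \<ge> - 1")
    case False
    then show ?thesis by (intro disjI2 exI[of _ "nat (- 2 - k)"]) auto
  next
    case True
    then show ?thesis by (cases "k = - 1") (auto intro!: exI[of _ "nat k"])
  qed
  have step: "\<tau> k < \<tau> (k + 1) \<and> X (k + 1) = X k + (\<tau> (k + 1) - \<tau> k) *\<^sub>R w k \<and>
     (\<forall>t. 0 < t \<and> t < \<tau> (k + 1) - \<tau> k \<longrightarrow> X k + t *\<^sub>R w k \<in> ?I) \<and>
     w (k + 1) = reflect_in_line (side zs (E (k + 1))) (w k)" for k
    using step_cases[of k]
  proof (elim disjE conjE exE)
    fix n assume k: "k = int n" "k + 1 = int (Suc n)"
    show ?thesis
      unfolding k(2) unfolding k(1) pos_simps
      using orb(2,6,7)[of "Suc n"] orb(5)[of _ "Suc n"] by (simp add: orb(8)[of "Suc n"])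
  next
    assume k: "k = - 1 - int 0" "k + 1 = int 0"
    have "p' 1 + t *\<^sub>R v 0 \<in> ?I" if "0 < t" "t < s' 0 + s 0" for t
    proof -
      have eq: "p' 1 + t *\<^sub>R v 0 = p 0 + (t - s' 0) *\<^sub>R v 0"
        using orb'(6)[of 0] start by (simp add: scaleR_left_diff_distrib)
      consider "t < s' 0" | "t = s' 0" | "t > s' 0" by linarith
      then show ?thesis
      proof cases
        case 1
        have "p' 0 + (s' 0 - t) *\<^sub>R v' 0 \<in> ?I"
          using orb'(5)[of "s' 0 - t" 0] 1 that by simp
        then show ?thesis
          unfolding eq using start by (simp add: scaleR_left_diff_distrib)
      next
        case 2
        then show ?thesis unfolding eq using start by simp
      next
        case 3
        then show ?thesis unfolding eq using orb(5)[of "t - s' 0" 0] that by simp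
      qed
    qed
    then show ?thesis
      unfolding k(2) unfolding k(1) pos_simps neg_simps
      using orb(2,6,7)[of 0] orb'(2,6,7)[of 0] T0 start
      by (simp add: orb(8)[of 0] orb'(8)[of 0] scaleR_add_left)
  next
    fix n assume k: "k = - 1 - int (Suc n)" "k + 1 = - 1 - int n"
    \<comment> \<open>Time reversal exchanges incoming and outgoing velocity; the law persists
      because reflections are involutions.\<close>
    have "v' n = reflect_in_line (side zs (e' n)) (v' (Suc n))"
      using reflect_in_line_invol flight_side_nonzero o' unfolding orbit_def by metis
    moreover have "p' (Suc n) + (s' (Suc n) - t) *\<^sub>R v' (Suc n) \<in> ?I"
      if "0 < t" "t < s' (Suc n)" for t
      using orb'(5)[of "s' (Suc n) - t" "Suc n"] that by simp
    ultimately show ?thesis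
      unfolding k(2) unfolding k(1) neg_simps
      using orb'(2)[of "Suc n"]
      by (simp add: orb'(8)[of "Suc n"] orb'(6)[of "Suc n"] reflect_in_line_minus
          scaleR_left_diff_distrib add_diff_eq)
  qed
  have less: "\<tau> i < \<tau> j" if "i < j" for i j
    using that
  proof (induction j rule: int_gr_induct)
    case base
    then show ?case using step by blast
  next
    case (step j)
    have "\<tau> j < \<tau> (j + 1)"
      using \<open>\<And>k. \<tau> k < \<tau> (k + 1) \<and> _ k\<close> by blast
    then show ?case using step by simp
  qed
  then have mono: "strict_mono \<tau>"
    by (rule strict_monoI)
  \<comment> \<open>At most one index fits since \<tau> is strictly increasing; a bounce time
    belongs to the flight that starts there.\<close>
  define \<gamma> where "\<gamma> = (\<lambda>t. let k = (SOME k. \<tau> k \<le> t \<and> t < \<tau> (k + 1)) in X k + (t - \<tau> k) *\<^sub>R w k)"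
  have \<gamma>: "\<gamma> t = X k + (t - \<tau> k) *\<^sub>R w k" if t: "\<tau> k \<le> t" "t < \<tau> (k + 1)" for t k
  proof -
    have "j = k" if "\<tau> j \<le> t \<and> t < \<tau> (j + 1)" for j
    proof -
      have "\<tau> j < \<tau> (k + 1)" "\<tau> k < \<tau> (j + 1)"
        using that t by linarith+
      then show ?thesis
        using mono by (simp add: strict_mono_less)
    qed
    then have "(SOME j. \<tau> j \<le> t \<and> t < \<tau> (j + 1)) = k"
      by (rule some_equality[rotated]) (use t in auto)
    then show ?thesis by (simp add: \<gamma>_def)
  qed
  have \<gamma>X: "\<gamma> (\<tau> k) = X k" for k
    using \<gamma>[of k "\<tau> k"] step[of k] by simp
  have top: "filterlim \<tau> at_top at_top"
    unfolding filterlim_at_top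
  proof
    fix Z
    obtain N where N: "\<And>n. n \<ge> N \<Longrightarrow> Z \<le> T n"
      using orbit_times_at_top[OF o] unfolding T_def filterlim_at_top eventually_sequentially
      by blast
    show "\<forall>\<^sub>F k in at_top. Z \<le> \<tau> k"
      unfolding eventually_at_top_linorder
    proof (intro exI allI impI)
      fix k :: int assume "k \<ge> int N"
      then show "Z \<le> \<tau> k"
        using N[of "nat (k + 1)"] by (simp add: \<tau>_def)
    qed
  qed
  have bot: "filterlim \<tau> at_bot at_bot"
    unfolding filterlim_at_bot
  proof
    fix Z
    obtain N where N: "\<And>n. n \<ge> N \<Longrightarrow> - Z \<le> T' n"
      using orbit_times_at_top[OF o'] unfolding T'_def filterlim_at_top eventually_sequentially
      by blast
    show "\<forall>\<^sub>F k in at_bot. \<tau> k \<le> Z"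
      unfolding eventually_at_bot_linorder
    proof (intro exI allI impI)
      fix k :: int assume "k \<le> - int N - 1"
      moreover from this have "N \<le> nat (- k)"
        by linarith
      ultimately show "\<tau> k \<le> Z"
        using N[of "nat (- k)"] by (simp add: \<tau>_def)
    qed
  qed
  have hit: "E k < length zs \<and> \<gamma> (\<tau> k) \<in> edge_interior zs (E k) \<and> cmod (w k) = 1" for k
    using nonneg_or_neg[of k] unfolding \<gamma>X
    by (elim disjE exE)
      (simp_all only: pos_simps neg_simps orb(1,3,4) orb'(1,3,4) norm_minus_cancel simp_thms)
  have line: "\<gamma> t = \<gamma> (\<tau> k) + (t - \<tau> k) *\<^sub>R w k" if "t \<in> {\<tau> k..\<tau> (k + 1)}" for t k
  proof (cases "t = \<tau> (k + 1)")
    case True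
    then show ?thesis using step[of k] by (simp add: \<gamma>X)
  next
    case False
    then show ?thesis using that \<gamma>[of k t] by (simp add: \<gamma>X)
  qed
  have ins: "\<gamma> t \<in> ?I" if "t \<in> {\<tau> k<..<\<tau> (k + 1)}" for t k
    using that \<gamma>[of k t] step[of k] by simp
  have refl: "w k = reflect_in_line (side zs (E k)) (w (k - 1))" for k
    using step[of "k - 1"] by simp
  have "nonsingular_trajectory zs \<gamma> \<tau> w E"
    unfolding nonsingular_trajectory_def
    by (intro conjI allI ballI mono top bot hit[THEN conjunct1] hit[THEN conjunct2, THEN conjunct1]
        hit[THEN conjunct2, THEN conjunct2] line ins refl)
  then show ?thesis
    using pos_simps(4) by blast
qed

subsection \<open>Perturbation of polygons\<close>

definition verts_tendsto :: "(nat \<Rightarrow> complex list) \<Rightarrow> complex list \<Rightarrow> bool" where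
  "verts_tendsto Q zs \<longleftrightarrow> (\<forall>n. length (Q n) = length zs) \<and>
     (\<forall>i<length zs. (\<lambda>n. Q n ! i) \<longlonglongrightarrow> zs ! i)"

lemma Suc_mod_less: "i < n \<Longrightarrow> Suc i mod n < (n::nat)"
  by (rule mod_less_divisor) simp

lemma verts_tendsto_next_vertex:
  "verts_tendsto Q zs \<Longrightarrow> i < length zs \<Longrightarrow> (\<lambda>n. next_vertex (Q n) i) \<longlonglongrightarrow> next_vertex zs i"
  unfolding verts_tendsto_def next_vertex_def by (simp add: Suc_mod_less)

lemma verts_tendsto_side:
  "verts_tendsto Q zs \<Longrightarrow> i < length zs \<Longrightarrow> (\<lambda>n. side (Q n) i) \<longlonglongrightarrow> side zs i"
  using verts_tendsto_next_vertex by (intro tendsto_diff) (auto simp: verts_tendsto_def)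

lemma verts_tendsto_subseq:
  "verts_tendsto Q zs \<Longrightarrow> strict_mono r \<Longrightarrow> verts_tendsto (\<lambda>n. Q (r n)) zs"
  unfolding verts_tendsto_def using LIMSEQ_subseq_LIMSEQ[where f = r] by (auto simp: o_def)

lemma bounded_real_subseq:
  fixes u :: "nat \<Rightarrow> real"
  assumes "\<And>n. u n \<in> {a..b}"
  obtains l r where "l \<in> {a..b}" "strict_mono r" "(\<lambda>n. u (r n)) \<longlonglongrightarrow> l"
proof -
  have "\<exists>l\<in>{a..b}. \<exists>r. strict_mono r \<and> (u \<circ> r) \<longlonglongrightarrow> l"
    using compact_Icc[of a b, unfolded compact_def, rule_format, of u] assms by blast
  then show thesis
    using that by (auto simp: o_def)
qed

text \<open>The parameters along the edges lie in the compact interval from 0 to 1; a limit of a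
  subsequence is a parameter of \<open>y0\<close>.\<close>

lemma edge_limit:
  assumes vt: "verts_tendsto Q zs" "i < length zs"
    and y: "\<And>n. y n \<in> edge (Q n) i" "y \<longlonglongrightarrow> y0"
  shows "y0 \<in> edge zs i"
proof -
  obtain u where u: "\<And>n. 0 \<le> u n \<and> u n \<le> 1 \<and> y n = Q n ! i + u n *\<^sub>R side (Q n) i"
    using y(1) unfolding mem_edge_iff by metis
  then have "\<And>n. u n \<in> {0..1}" by simp
  then obtain l r where l: "l \<in> {0..1}" "strict_mono r" "(\<lambda>n. u (r n)) \<longlonglongrightarrow> l"
    by (rule bounded_real_subseq[of u])
  have vt': "verts_tendsto (\<lambda>n. Q (r n)) zs"
    using verts_tendsto_subseq vt(1) l(2) by blast
  have "(\<lambda>n. Q (r n) ! i + u (r n) *\<^sub>R side (Q (r n)) i) \<longlonglongrightarrow> zs ! i + l *\<^sub>R side zs i"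
    using vt' vt(2) by (intro tendsto_add tendsto_scaleR l verts_tendsto_side) (auto simp: verts_tendsto_def)
  moreover have "(\<lambda>n. y (r n)) \<longlonglongrightarrow> y0"
    using LIMSEQ_subseq_LIMSEQ[OF y(2) l(2)] by (simp add: o_def)
  ultimately have "y0 = zs ! i + l *\<^sub>R side zs i"
    using u by (simp add: LIMSEQ_unique)
  then show ?thesis
    using l(1) unfolding mem_edge_iff by auto
qed

lemma polygon_nondegenerate:
  assumes "polygon zs" "i < length zs"
  shows "zs ! i \<noteq> next_vertex zs i"
proof -
  have "Suc i mod length zs \<noteq> i"
    using assms by (cases "Suc i = length zs") (auto simp: polygon_def)
  moreover have "Suc i mod length zs < length zs"
    using assms by (simp add: Suc_mod_less)
  ultimately show ?thesis
    using assms by (simp add: polygon_def next_vertex_def nth_eq_iff_index_eq)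
qed

text \<open>Two segments with a common endpoint \<open>b\<close> that meet elsewhere have \<open>(c - b) / (a - b)\<close>
  in the closed set of nonnegative reals.\<close>

lemma adjacent_segments_limit:
  fixes a b c :: complex
  assumes lim: "A \<longlonglongrightarrow> a" "B \<longlonglongrightarrow> b" "C \<longlonglongrightarrow> c" and "a \<noteq> b" "c \<noteq> b"
    and meet: "\<And>n. y n \<in> open_segment (A n) (B n)" "\<And>n. y n \<in> closed_segment (B n) (C n)"
  shows "\<not> closed_segment a b \<inter> closed_segment b c \<subseteq> {a, b}"
proof -
  \<comment> \<open>Measured from \<open>B n\<close>, the common point is \<alpha> times one side
    vector and \<beta> times the other, so their quotient is the nonnegative real
    \<open>\<alpha> / \<beta>\<close>.\<close>
  have "(C n - B n) / (A n - B n) \<in> \<real>\<^sub>\<ge>\<^sub>0" for n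
  proof -
    obtain \<alpha> where \<alpha>: "A n \<noteq> B n" "0 < \<alpha>" "\<alpha> < 1" "y n = (1 - \<alpha>) *\<^sub>R B n + \<alpha> *\<^sub>R A n"
      using meet(1)[of n] unfolding open_segment_commute[of "A n"] by (auto simp: in_segment)
    obtain \<beta> where \<beta>: "0 \<le> \<beta>" "y n = (1 - \<beta>) *\<^sub>R B n + \<beta> *\<^sub>R C n"
      using meet(2)[of n] by (auto simp: in_segment)
    have eq: "\<alpha> *\<^sub>R (A n - B n) = \<beta> *\<^sub>R (C n - B n)"
      using \<alpha>(4) \<beta>(2) by (simp add: algebra_simps)
    then have "\<beta> \<noteq> 0"
      using \<alpha> by auto
    then have "C n - B n = (1 / \<beta>) *\<^sub>R (\<alpha> *\<^sub>R (A n - B n))"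
      unfolding eq by simp
    then have "C n - B n = of_real (\<alpha> / \<beta>) * (A n - B n)"
      by (simp add: scaleR_conv_of_real)
    then have "(C n - B n) / (A n - B n) = of_real (\<alpha> / \<beta>)"
      using \<alpha>(1) by simp
    then show ?thesis
      using \<alpha>(2) \<beta>(1) by simp
  qed
  moreover have "(\<lambda>n. (C n - B n) / (A n - B n)) \<longlonglongrightarrow> (c - b) / (a - b)"
    using assms by (intro tendsto_intros) auto
  ultimately have "(c - b) / (a - b) \<in> \<real>\<^sub>\<ge>\<^sub>0"
    by (rule closed_sequentially[OF closed_nonneg_Reals_complex])
  then obtain \<kappa> where \<kappa>: "\<kappa> \<ge> 0" "(c - b) / (a - b) = of_real \<kappa>"
    by (auto elim: nonneg_Reals_cases)
  then have c: "c = b + \<kappa> *\<^sub>R (a - b)"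
    using \<open>a \<noteq> b\<close> by (simp add: scaleR_conv_of_real field_simps)
  then have "\<kappa> > 0"
    using \<kappa>(1) \<open>c \<noteq> b\<close> by (cases "\<kappa> = 0") auto
  \<comment> \<open>Halving the minimum puts \<open>z\<close> strictly between \<open>b\<close> and
    \<open>a\<close> and not beyond \<open>c\<close>.\<close>
  define \<mu> where "\<mu> = min 1 \<kappa> / 2"
  have \<mu>: "0 < \<mu>" "\<mu> < 1" "\<mu> \<le> \<kappa>"
    using \<open>\<kappa> > 0\<close> by (auto simp: \<mu>_def min_def)
  define z where "z = b + \<mu> *\<^sub>R (a - b)"
  have "z \<in> open_segment b a"
    using \<mu> \<open>a \<noteq> b\<close> by (auto simp: in_segment z_def algebra_simps intro!: exI[of _ \<mu>])
  then have "z \<in> closed_segment a b" "z \<notin> {a, b}"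
    by (auto simp: open_segment_def closed_segment_commute)
  moreover have "z \<in> closed_segment b c"
    unfolding in_segment
  proof (intro exI conjI)
    show "0 \<le> \<mu> / \<kappa>" "\<mu> / \<kappa> \<le> 1"
      using \<mu> \<open>\<kappa> > 0\<close> by auto
    have "(1 - \<mu> / \<kappa>) *\<^sub>R b + (\<mu> / \<kappa>) *\<^sub>R c = b + (\<mu> / \<kappa> * \<kappa>) *\<^sub>R (a - b)"
      unfolding c by (simp add: scaleR_right_distrib scaleR_left_diff_distrib)
    then show "z = (1 - \<mu> / \<kappa>) *\<^sub>R b + (\<mu> / \<kappa>) *\<^sub>R c"
      using \<open>\<kappa> > 0\<close> by (simp add: z_def)
  qed
  ultimately show ?thesis by blast
qed

text \<open>A limit of meeting points is on both limit edges, hence a common vertex of them. There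
  the positions alone give no contradiction; but then the edges of each tuple share the vertex with
  the same index, and meeting once more forces their directions to agree in the limit.\<close>

lemma eventually_disjoint_edges:
  assumes vt: "verts_tendsto Q zs" and poly: "polygon zs"
    and ij: "i < length zs" "j < length zs" "i \<noteq> j"
  shows "\<forall>\<^sub>F n in sequentially. edge_interior (Q n) i \<inter> edge (Q n) j = {}"
proof (rule ccontr)
  assume "\<not> ?thesis"
  from not_eventually_sequentiallyD[OF this]
  obtain r :: "nat \<Rightarrow> nat" where r: "strict_mono r" "\<And>n. edge_interior (Q (r n)) i \<inter> edge (Q (r n)) j \<noteq> {}"
    by auto
  then have "\<forall>n. \<exists>u. 0 < u \<and> u < 1 \<and>
      Q (r n) ! i + u *\<^sub>R side (Q (r n)) i \<in> edge_interior (Q (r n)) i \<inter> edge (Q (r n)) j"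
    unfolding mem_edge_interior_iff Int_iff by (metis disjoint_iff mem_edge_interior_iff)
  then obtain u where u: "\<And>n. 0 < u n \<and> u n < 1 \<and>
      Q (r n) ! i + u n *\<^sub>R side (Q (r n)) i \<in> edge_interior (Q (r n)) i \<inter> edge (Q (r n)) j"
    by metis
  then have "\<And>n. u n \<in> {0..1}"
    by (simp add: less_imp_le)
  then obtain l r' where l: "l \<in> {0..1}" "strict_mono r'" "(\<lambda>n. u (r' n)) \<longlonglongrightarrow> l"
    by (rule bounded_real_subseq[of u])
  define R where "R = (\<lambda>n. Q (r (r' n)))"
  define y where "y = (\<lambda>n. R n ! i + u (r' n) *\<^sub>R side (R n) i)"
  have vR: "verts_tendsto R zs"
    unfolding R_def by (rule verts_tendsto_subseq[OF verts_tendsto_subseq[OF vt r(1)] l(2)])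
  then have R: "(\<lambda>n. R n ! k) \<longlonglongrightarrow> zs ! k" "length (R n) = length zs" if "k < length zs" for k n
    using that by (auto simp: verts_tendsto_def)
  have y: "y n \<in> edge_interior (R n) i" "y n \<in> edge (R n) j" for n
    using u by (auto simp: y_def R_def)
  have ylim: "y \<longlonglongrightarrow> zs ! i + l *\<^sub>R side zs i" (is "_ \<longlonglongrightarrow> ?y0")
    unfolding y_def using R ij vR by (intro tendsto_add tendsto_scaleR l verts_tendsto_side)
  have "?y0 \<in> edge zs i" "?y0 \<in> edge zs j"
    using edge_limit[OF vR _ _ ylim] ij y edge_interior_subset_edge by blast+
  then have y0: "?y0 \<in> {zs ! i, next_vertex zs i} \<inter> {zs ! j, next_vertex zs j}"
    using poly ij unfolding polygon_def by blast
  have sub: "edge zs i \<inter> edge zs j \<subseteq> {zs ! i, next_vertex zs i}"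
    using poly ij unfolding polygon_def by blast
  define i' where "i' = Suc i mod length zs"
  define j' where "j' = Suc j mod length zs"
  have i'j': "i' < length zs" "j' < length zs"
    using ij by (auto simp: i'_def j'_def intro: Suc_mod_less)
  have nv: "next_vertex zs i = zs ! i'" "next_vertex zs j = zs ! j'"
    "next_vertex (R n) i = R n ! i'" "next_vertex (R n) j = R n ! j'" for n
    using R(2)[OF ij(1)] by (auto simp: next_vertex_def i'_def j'_def)
  have nd: "zs ! i \<noteq> zs ! i'" "zs ! j \<noteq> zs ! j'"
    using polygon_nondegenerate[OF poly ij(1)] polygon_nondegenerate[OF poly ij(2)]
    unfolding nv by auto
  \<comment> \<open>\<beta> is the index of the shared vertex, \<alpha> and \<gamma> those of the
    other ends. Each edge has two ends, so four instances cover all cases.\<close>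
  have common: False
    if k: "\<alpha> < length zs" "\<beta> < length zs" "\<gamma> < length zs" "zs ! \<alpha> \<noteq> zs ! \<beta>" "zs ! \<gamma> \<noteq> zs ! \<beta>"
      and ends: "{i, i'} = {\<alpha>, \<beta>}" "{j, j'} = {\<gamma>, \<beta>}" for \<alpha> \<beta> \<gamma>
  proof -
    have "open_segment (R n ! \<alpha>) (R n ! \<beta>) = edge_interior (R n) i"
      "closed_segment (R n ! \<beta>) (R n ! \<gamma>) = edge (R n) j" for n
      using ends unfolding edge_interior_def edge_def nv
      by (auto simp: doubleton_eq_iff open_segment_commute closed_segment_commute)
    then have "\<not> closed_segment (zs ! \<alpha>) (zs ! \<beta>) \<inter> closed_segment (zs ! \<beta>) (zs ! \<gamma>) \<subseteq> {zs ! \<alpha>, zs ! \<beta>}"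
      using R(1) k y
      by (intro adjacent_segments_limit[where y = y and A = "\<lambda>n. R n ! \<alpha>"
            and B = "\<lambda>n. R n ! \<beta>" and C = "\<lambda>n. R n ! \<gamma>"]) auto
    moreover have "closed_segment (zs ! \<alpha>) (zs ! \<beta>) = edge zs i"
      "closed_segment (zs ! \<beta>) (zs ! \<gamma>) = edge zs j" "{zs ! \<alpha>, zs ! \<beta>} = {zs ! i, next_vertex zs i}"
      using ends unfolding edge_def nv by (auto simp: doubleton_eq_iff closed_segment_commute)
    ultimately show False using sub by simp
  qed
  have inj: "a = b" if "zs ! a = zs ! b" "a < length zs" "b < length zs" for a b
    using that poly by (simp add: polygon_def nth_eq_iff_index_eq)
  from y0 obtain \<beta> where "\<beta> \<in> {i, i'}" "\<beta> \<in> {j, j'}"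
    unfolding nv using inj ij i'j' by (metis IntE insertE insertI1 insertI2 singletonD)
  then show False
    using common[of i' i j'] common[of i' i j] common[of i i' j'] common[of i i' j] ij i'j' nd
    by (auto simp: insert_commute)
qed

lemma eventually_simple_edges:
  assumes "verts_tendsto Q zs" "polygon zs"
  shows "\<forall>\<^sub>F n in sequentially. simple_edges (Q n)"
proof -
  have "\<forall>\<^sub>F n in sequentially. \<forall>i\<in>{..<length zs}. \<forall>j\<in>{..<length zs} - {i}.
      edge_interior (Q n) i \<inter> edge (Q n) j = {}"
    using eventually_disjoint_edges[OF assms] by (intro eventually_ball_finite ballI) auto
  moreover have "length (Q n) = length zs" for n
    using assms(1) by (simp add: verts_tendsto_def)
  ultimately show ?thesis
    by (auto simp: simple_edges_def elim!: eventually_mono)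
qed

lemma polygon_simple_edges: "polygon zs \<Longrightarrow> simple_edges zs"
  using eventually_simple_edges[of "\<lambda>_. zs" zs] by (simp add: verts_tendsto_def)

text \<open>By Borsuk's criterion \<open>x\<close> is in a bounded component of the complement of \<open>S\<close> if and only if
  the radial projection of \<open>S\<close> from \<open>x\<close> is essential. A null homotopy for \<open>S'\<close> composes with \<open>f\<close>
  to one for \<open>S\<close>.\<close>

lemma inside_perturb:
  fixes x :: "'a::euclidean_space"
  assumes "compact S" "compact S'" "continuous_on S f" "f \<in> S \<rightarrow> S'" "x \<in> inside S" "x \<notin> S'"
    and near: "\<And>y. y \<in> S \<Longrightarrow> dist (f y) y < dist x y"
  shows "x \<in> inside S'"
proof -
  define \<beta> where "\<beta> = (\<lambda>y. inverse (norm (y - x)) *\<^sub>R (y - x))"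
  have x: "x \<notin> S" "bounded (connected_component_set (- S) x)"
    using assms(5) by (auto simp: inside_def)
  \<comment> \<open>The straight line homotopy works: points between \<open>y\<close> and
    \<open>f y\<close> are closer to \<open>y\<close> than \<open>x\<close> is.\<close>
  have "homotopic_with_canon (\<lambda>_. True) S (- {x}) id f"
  proof (rule homotopic_with_linear)
    fix y assume y: "y \<in> S"
    show "closed_segment (id y) (f y) \<subseteq> - {x}"
    proof clarify
      assume "x \<in> closed_segment (id y) (f y)"
      then have "dist x y \<le> dist (f y) y"
        using dist_in_closed_segment(1)[of x y "f y"] by (simp add: dist_commute)
      then show False using near[OF y] by simp
    qed
  qed (use assms(3) in \<open>auto simp: continuous_on_id\<close>)
  moreover have "continuous_on (- {x}) \<beta>"
    unfolding \<beta>_def by (intro continuous_intros) auto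
  moreover have "\<beta> \<in> - {x} \<rightarrow> sphere 0 1"
    by (auto simp: \<beta>_def)
  ultimately have hom: "homotopic_with_canon (\<lambda>_. True) S (sphere 0 1) \<beta> (\<beta> \<circ> f)"
    using homotopic_with_compose_continuous_left[of "\<lambda>_. True" \<beta> S "- {x}" id f "sphere 0 1"] by simp
  have "bounded (connected_component_set (- S') x)"
  proof (rule ccontr)
    assume "\<not> bounded (connected_component_set (- S') x)"
    then obtain c where "homotopic_with_canon (\<lambda>_. True) S' (sphere 0 1) \<beta> (\<lambda>_. c)"
      using Borsuk_map_essential_bounded_component[OF assms(2,6)] unfolding \<beta>_def by blast
    then have "homotopic_with_canon (\<lambda>_. True) S (sphere 0 1) (\<beta> \<circ> f) ((\<lambda>_. c) \<circ> f)"
      using assms(3,4) by (intro homotopic_with_compose_continuous_right[of "\<lambda>_. True"]) auto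
    then have "homotopic_with_canon (\<lambda>_. True) S (sphere 0 1) \<beta> (\<lambda>_. c)"
      using homotopic_with_trans[OF hom] by (simp add: o_def)
    then show False
      using Borsuk_map_essential_bounded_component[OF assms(1) x(1)] x(2) unfolding \<beta>_def by blast
  qed
  then show ?thesis
    using assms(6) by (simp add: inside_def)
qed

text \<open>The boundary is carried over edge by edge with the parameters kept. These maps fit
  together because different edges of a polygon meet only in common vertices.\<close>

lemma inside_polygon_perturb:
  assumes poly: "polygon zs" and len: "length ts = length zs"
    and x: "x \<in> inside (polygon_boundary zs)" "\<And>y. y \<in> polygon_boundary zs \<Longrightarrow> d \<le> dist x y"
    and near: "\<And>i. i < length zs \<Longrightarrow> cmod (ts ! i - zs ! i) < d"
  shows "x \<in> inside (polygon_boundary ts)"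
proof -
  \<comment> \<open>The complex affine map sending the two ends of edge \<open>i\<close> of
    \<open>zs\<close> to those of \<open>ts\<close>, written without a parameter so that its
    continuity is immediate.\<close>
  define g where "g = (\<lambda>i y. ts ! i + ((y - zs ! i) / side zs i) * side ts i)"
  define f where "f = (\<lambda>y. g (SOME i. i < length zs \<and> y \<in> edge zs i) y)"
  have nd: "zs ! i \<noteq> next_vertex zs i" if "i < length zs" for i
    using polygon_nondegenerate[OF poly that] .
  have g_param: "g i (zs ! i + u *\<^sub>R side zs i) = ts ! i + u *\<^sub>R side ts i" if "i < length zs" for i u
    using nd[OF that] by (simp add: g_def scaleR_conv_of_real)
  have nv: "next_vertex zs i = zs ! (Suc i mod length zs)" "next_vertex ts i = ts ! (Suc i mod length zs)" for i
    by (simp_all add: next_vertex_def len)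
  have less: "Suc i mod length zs < length zs" if "i < length zs" for i
    using that by (rule Suc_mod_less)
  have g_vertex: "g i (zs ! k) = ts ! k"
    if "i < length zs" "k < length zs" "zs ! k \<in> {zs ! i, next_vertex zs i}" for i k
  proof -
    have "k = i \<or> k = Suc i mod length zs"
      using that poly less by (auto simp: nv polygon_def nth_eq_iff_index_eq)
    then show ?thesis
    proof
      assume "k = i"
      then show ?thesis using g_param[OF that(1), of 0] by simp
    next
      assume "k = Suc i mod length zs"
      then show ?thesis using g_param[OF that(1), of 1] by (simp add: nv)
    qed
  qed
  have g_eq: "g i y = g j y"
    if ij: "i < length zs" "j < length zs" and y: "y \<in> edge zs i" "y \<in> edge zs j" for i j y
  proof (cases "i = j")
    case False
    then have "y \<in> {zs ! i, next_vertex zs i} \<inter> {zs ! j, next_vertex zs j}"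
      using poly ij y unfolding polygon_def by blast
    moreover from this obtain k where "k < length zs" "y = zs ! k"
      using ij less nv by auto
    ultimately show ?thesis
      using g_vertex ij by auto
  qed simp
  have f: "f y = g i y" if "i < length zs" "y \<in> edge zs i" for i y
  proof -
    let ?j = "SOME j. j < length zs \<and> y \<in> edge zs j"
    have "?j < length zs \<and> y \<in> edge zs ?j"
      by (rule someI[of _ i]) (use that in simp)
    then show ?thesis
      unfolding f_def using g_eq that by blast
  qed
  \<comment> \<open>The displacement at parameter \<open>u\<close> is a convex combination of the
    displacements of the two ends.\<close>
  have move: "dist (ts ! i + u *\<^sub>R side ts i) (zs ! i + u *\<^sub>R side zs i) < d"
    if i: "i < length zs" and u: "0 \<le> u" "u \<le> 1" for i u
  proof -
    have "ts ! i + u *\<^sub>R side ts i - (zs ! i + u *\<^sub>R side zs i) =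
        (1 - u) *\<^sub>R (ts ! i - zs ! i) + u *\<^sub>R (next_vertex ts i - next_vertex zs i)"
      by (simp add: algebra_simps)
    moreover have "(1 - u) *\<^sub>R (ts ! i - zs ! i) + u *\<^sub>R (next_vertex ts i - next_vertex zs i) \<in> ball 0 d"
      using near[OF i] near[OF less[OF i]] u by (intro convexD[OF convex_ball]) (auto simp: nv)
    ultimately show ?thesis by (simp only: dist_norm mem_ball_0)
  qed
  have edge_in: "edge zs i \<subseteq> polygon_boundary zs" "edge ts i \<subseteq> polygon_boundary ts"
    if "i < length zs" for i
    using that len by (auto simp: polygon_boundary_def)
  show ?thesis
  proof (rule inside_perturb[OF compact_polygon_boundary compact_polygon_boundary _ _ x(1)])
    have "continuous_on (edge zs i) f" if "i < length zs" for i
    proof -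
      have "continuous_on (edge zs i) (g i)"
        unfolding g_def using nd[OF that] by (intro continuous_intros) auto
      then show ?thesis
        using f[OF that] by (simp cong: continuous_on_cong)
    qed
    then show "continuous_on (polygon_boundary zs) f"
      unfolding polygon_boundary_def by (intro continuous_on_closed_Union) (auto simp: closed_edge)
    have fy: "f y \<in> polygon_boundary ts \<and> dist (f y) y < d" if y: "y \<in> polygon_boundary zs" for y
    proof -
      obtain i where i: "i < length zs" "y \<in> edge zs i"
        using y by (auto simp: polygon_boundary_def)
      then obtain u where u: "0 \<le> u" "u \<le> 1" "y = zs ! i + u *\<^sub>R side zs i"
        by (auto simp: mem_edge_iff)
      have fy: "f y = ts ! i + u *\<^sub>R side ts i"
        using f[OF i] g_param[OF i(1)] u(3) by simp
      then have "f y \<in> edge ts i"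
        using u(1,2) unfolding mem_edge_iff by blast
      moreover have "dist (f y) y < d"
        using move[OF i(1) u(1,2)] u(3) fy by simp
      ultimately show ?thesis
        using edge_in[OF i(1)] by blast
    qed
    then show "f \<in> polygon_boundary zs \<rightarrow> polygon_boundary ts"
      by blast
    show "dist (f y) y < dist x y" if "y \<in> polygon_boundary zs" for y
      using fy[OF that] x(2)[OF that] by simp
    show "x \<notin> polygon_boundary ts"
    proof
      assume "x \<in> polygon_boundary ts"
      then obtain i u where iu: "i < length zs" "0 \<le> u" "u \<le> 1" "x = ts ! i + u *\<^sub>R side ts i"
        by (auto simp: polygon_boundary_def mem_edge_iff len)
      then have "zs ! i + u *\<^sub>R side zs i \<in> edge zs i"
        unfolding mem_edge_iff by blast
      then have "zs ! i + u *\<^sub>R side zs i \<in> polygon_boundary zs"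
        using edge_in(1)[OF iu(1)] by blast
      then show False
        using x(2) move[OF iu(1-3)] iu(4) by fastforce
    qed
  qed
qed

lemma eventually_inside:
  assumes vt: "verts_tendsto Q zs" and "polygon zs" "x \<in> inside (polygon_boundary zs)"
  shows "\<forall>\<^sub>F n in sequentially. x \<in> inside (polygon_boundary (Q n))"
proof -
  have "x \<notin> polygon_boundary zs"
    using assms(3) inside_no_overlap by blast
  then obtain d where d: "d > 0" "\<And>y. y \<in> polygon_boundary zs \<Longrightarrow> d \<le> dist x y"
    using separate_point_closed[OF closed_polygon_boundary] by metis
  have "\<forall>\<^sub>F n in sequentially. \<forall>i\<in>{..<length zs}. dist (Q n ! i) (zs ! i) < d"
    using vt d(1) by (intro eventually_ball_finite) (auto simp: verts_tendsto_def intro: tendstoD)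
  then show ?thesis
  proof (rule eventually_mono)
    fix n assume "\<forall>i\<in>{..<length zs}. dist (Q n ! i) (zs ! i) < d"
    then show "x \<in> inside (polygon_boundary (Q n))"
      using vt by (intro inside_polygon_perturb[OF assms(2) _ assms(3) d(2)])
        (auto simp: verts_tendsto_def dist_norm)
  qed
qed

subsection \<open>Perturbation of orbits\<close>

lemma edge_convex:
  assumes "p \<in> edge zs i" "p + s *\<^sub>R v \<in> edge zs i" "0 \<le> t" "t \<le> s"
  shows "p + t *\<^sub>R v \<in> edge zs i"
proof (cases "s = 0")
  case False
  have "(1 - t / s) *\<^sub>R p + (t / s) *\<^sub>R (p + s *\<^sub>R v) \<in> edge zs i"
    using assms False unfolding edge_def by (intro convexD[OF convex_closed_segment]) auto
  moreover have "(1 - t / s) *\<^sub>R p + (t / s) *\<^sub>R (p + s *\<^sub>R v) = p + t *\<^sub>R v"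
    using False by (simp add: algebra_simps)
  ultimately show ?thesis by simp
qed (use assms in auto)

text \<open>Edges are convex, so a flight from an edge back to the same edge would run along
  it.\<close>

lemma flight_leaves_edge:
  assumes "flight zs p v s e" "p \<in> edge zs e"
  shows False
proof -
  have s: "0 < s" "e < length zs" "p + s *\<^sub>R v \<in> edge zs e"
    using assms(1) edge_interior_subset_edge by (auto simp: flight_def)
  then have "p + (s / 2) *\<^sub>R v \<in> edge zs e"
    using edge_convex[OF assms(2) s(3), of "s / 2"] by simp
  then show False
    using flight_avoids_edge[OF assms(1), of "s / 2" e] s by simp
qed

text \<open>The line of a nearby flight meets the line of edge \<open>e0\<close> at a time \<open>t n\<close> that tends to \<open>s0\<close>,
  at an interior point of the edge. Hitting another edge before infinitely often would, by
  compactness, force the limit flight to meet that edge too.\<close>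

lemma flight_limit:
  assumes vt: "verts_tendsto Q zs" and simple: "simple_edges zs"
    and p: "p \<longlonglongrightarrow> p0" and v: "v \<longlonglongrightarrow> v0" and fl0: "flight zs p0 v0 s0 e0"
    and fl: "\<And>n. flight (Q n) (p n) (v n) (s n) (e n)"
    and start: "p0 \<in> inside (polygon_boundary zs) \<or>
      (\<exists>e'<length zs. p0 \<in> edge_interior zs e' \<and> (\<forall>\<^sub>F n in sequentially. p n \<in> edge (Q n) e'))"
  shows "\<forall>\<^sub>F n in sequentially. e n = e0" "s \<longlonglongrightarrow> s0"
proof -
  have len: "length (Q n) = length zs" for n
    using vt by (simp add: verts_tendsto_def)
  have e0: "e0 < length zs" "0 < s0" "p0 + s0 *\<^sub>R v0 \<in> edge_interior zs e0"
    using fl0 by (auto simp: flight_def)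
  define D where "D = (\<lambda>n. side (Q n) e0)"
  define d where "d = side zs e0"
  define a where "a = zs ! e0"
  have D: "D \<longlonglongrightarrow> d" and A: "(\<lambda>n. Q n ! e0) \<longlonglongrightarrow> a"
    using verts_tendsto_side[OF vt e0(1)] vt e0(1) by (auto simp: D_def d_def a_def verts_tendsto_def)
  obtain u where u: "0 < u" "u < 1" "p0 + s0 *\<^sub>R v0 = a + u *\<^sub>R d"
    using e0(3) by (auto simp: mem_edge_interior_iff a_def d_def)
  have dn: "d \<noteq> 0"
    using flight_side_nonzero[OF fl0] by (simp add: d_def)
  have tr0: "v0 \<bullet> (\<i> * d) \<noteq> 0"
    using flight_transversal[OF fl0] by (simp add: d_def)
  have perp: "(c *\<^sub>R z) \<bullet> (\<i> * z) = 0" for c and z :: complex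
    by (simp add: inner_complex_def)
  \<comment> \<open>The solution of the linear equation for crossing the line of edge
    \<open>e0\<close>; its denominator is nonzero for all large \<open>n\<close> by transversality
    of the limit flight.\<close>
  define t where "t = (\<lambda>n. ((Q n ! e0 - p n) \<bullet> (\<i> * D n)) / (v n \<bullet> (\<i> * D n)))"
  have t: "t \<longlonglongrightarrow> s0"
  proof -
    have "t \<longlonglongrightarrow> ((a - p0) \<bullet> (\<i> * d)) / (v0 \<bullet> (\<i> * d))"
      unfolding t_def by (intro tendsto_intros A p D v tr0)
    moreover have "a - p0 = s0 *\<^sub>R v0 - u *\<^sub>R d"
      using u(3) by (simp add: algebra_simps)
    then have "(a - p0) \<bullet> (\<i> * d) = s0 * (v0 \<bullet> (\<i> * d))"
      using perp[of u d] by (simp add: inner_diff_left)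
    ultimately show ?thesis using tr0 by simp
  qed
  define y where "y = (\<lambda>n. p n + t n *\<^sub>R v n)"
  define q where "q = (\<lambda>n. ((y n - Q n ! e0) \<bullet> D n) / (D n \<bullet> D n))"
  have "y \<longlonglongrightarrow> a + u *\<^sub>R d"
    unfolding y_def u(3)[symmetric] by (intro tendsto_intros p t v)
  then have "q \<longlonglongrightarrow> ((a + u *\<^sub>R d - a) \<bullet> d) / (d \<bullet> d)"
    unfolding q_def using dn by (intro tendsto_intros A D) auto
  then have q: "q \<longlonglongrightarrow> u"
    using dn by simp
  have ev_dn: "\<forall>\<^sub>F n in sequentially. D n \<noteq> 0"
    using D dn by (rule tendsto_imp_eventually_ne)
  have ev_tr: "\<forall>\<^sub>F n in sequentially. v n \<bullet> (\<i> * D n) \<noteq> 0"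
    by (rule tendsto_imp_eventually_ne[OF _ tr0]) (intro tendsto_intros v D)
  have ev_t: "\<forall>\<^sub>F n in sequentially. t n \<in> {0<..}"
    by (rule topological_tendstoD[OF t]) (use e0 in auto)
  have ev_q: "\<forall>\<^sub>F n in sequentially. q n \<in> {0<..<1}"
    by (rule topological_tendstoD[OF q]) (use u in auto)
  \<comment> \<open>For large \<open>n\<close> the crossing point has parameter \<open>q n\<close>
    strictly between 0 and 1, so it is on the edge itself, and the flight must have ended by
    then.\<close>
  have ev_le: "\<forall>\<^sub>F n in sequentially. s n \<le> t n"
    using ev_dn ev_tr ev_t ev_q
  proof eventually_elim
    case (elim n)
    have "(y n - Q n ! e0) \<bullet> (\<i> * D n) = t n * (v n \<bullet> (\<i> * D n)) - (Q n ! e0 - p n) \<bullet> (\<i> * D n)"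
      by (simp add: y_def inner_diff_left inner_add_left)
    also have "\<dots> = 0"
      using elim(2) by (simp add: t_def)
    finally obtain c where c: "y n - Q n ! e0 = c *\<^sub>R D n"
      using parallel_if_inner_normal_zero[OF elim(1)] by blast
    then have "q n = c"
      using elim(1) by (simp add: q_def)
    then have "0 \<le> c \<and> c \<le> 1 \<and> y n = Q n ! e0 + c *\<^sub>R side (Q n) e0"
      using c elim(4) by (simp add: D_def algebra_simps)
    then have "p n + t n *\<^sub>R v n \<in> edge (Q n) e0"
      unfolding mem_edge_iff y_def by blast
    then show "s n \<le> t n"
      using flight_avoids_edge[OF fl[of n], of "t n" e0] elim(3) e0(1) len by force
  qed
  obtain B where B: "\<And>n. \<bar>t n\<bar> \<le> B"
    using convergent_imp_Bseq[OF convergentI[OF t]] by (auto simp: Bseq_def)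
  have other: "\<forall>\<^sub>F n in sequentially. e n \<noteq> i" if i: "i < length zs" "i \<noteq> e0" for i
  proof (rule ccontr)
    assume neg: "\<not> ?thesis"
    \<comment> \<open>The bound is built into the negated statement so that one subsequence has both
      properties.\<close>
    have "\<not> (\<forall>\<^sub>F n in sequentially. s n \<le> t n \<longrightarrow> e n \<noteq> i)"
    proof
      assume "\<forall>\<^sub>F n in sequentially. s n \<le> t n \<longrightarrow> e n \<noteq> i"
      with ev_le have "\<forall>\<^sub>F n in sequentially. e n \<noteq> i"
        by eventually_elim blast
      then show False using neg by simp
    qed
    from not_eventually_sequentiallyD[OF this]
    obtain r :: "nat \<Rightarrow> nat" where r: "strict_mono r" "\<And>n. s (r n) \<le> t (r n)" "\<And>n. e (r n) = i"
      by auto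
    have "s (r n) \<in> {0..B}" for n
      using fl[of "r n"] r(2)[of n] B[of "r n"] by (auto simp: flight_def)
    then obtain \<sigma> r' where \<sigma>: "\<sigma> \<in> {0..B}" "strict_mono r'" "(\<lambda>n. s (r (r' n))) \<longlonglongrightarrow> \<sigma>"
      by (rule bounded_real_subseq[of "\<lambda>n. s (r n)"])
    define R where "R = r \<circ> r'"
    have R: "strict_mono R" "\<And>n. s (R n) \<le> t (R n)" "\<And>n. e (R n) = i" "(\<lambda>n. s (R n)) \<longlonglongrightarrow> \<sigma>"
      using r \<sigma> strict_mono_o[OF r(1) \<sigma>(2)] by (auto simp: R_def)
    have lim: "(\<lambda>n. f (R n)) \<longlonglongrightarrow> l" if "f \<longlonglongrightarrow> l" for f :: "nat \<Rightarrow> 'z::topological_space" and l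
      using LIMSEQ_subseq_LIMSEQ[OF that R(1)] by (simp add: o_def)
    have "\<sigma> \<le> s0"
      by (rule LIMSEQ_le[OF R(4) lim[OF t]]) (use R(2) in blast)
    have hit: "p (R n) + s (R n) *\<^sub>R v (R n) \<in> edge (Q (R n)) i" for n
      using fl[of "R n"] R(3)[of n] edge_interior_subset_edge by (auto simp: flight_def)
    have mem: "p0 + \<sigma> *\<^sub>R v0 \<in> edge zs i"
      by (rule edge_limit[OF verts_tendsto_subseq[OF vt R(1)] i(1) hit])
        (intro tendsto_intros lim p v R(4))
    \<comment> \<open>The limit \<sigma> of the hitting times on edge \<open>i\<close> falls at the
      end, in the open part or at the start of the limit flight.\<close>
    consider "\<sigma> = s0" | "0 < \<sigma>" "\<sigma> < s0" | "\<sigma> = 0"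
      using \<sigma>(1) \<open>\<sigma> \<le> s0\<close> by fastforce
    then show False
    proof cases
      case 1
      then show False
        using mem e0 simple i unfolding simple_edges_def by blast
    next
      case 2
      then show False
        using flight_avoids_edge[OF fl0 _ _ i(1)] mem by blast
    next
      case 3
      \<comment> \<open>Hitting times can shrink to 0 only if the limit flight starts on edge
        \<open>i\<close>. By \<open>start\<close> the nearby flights then start on that edge too,
        and they cannot return to it at once.\<close>
      then have p0: "p0 \<in> edge zs i"
        using mem by simp
      then have "p0 \<notin> inside (polygon_boundary zs)"
        using i(1) inside_no_overlap[of "polygon_boundary zs"] unfolding polygon_boundary_def by blast
      then obtain e' where e': "e' < length zs" "p0 \<in> edge_interior zs e'"
        "\<forall>\<^sub>F n in sequentially. p n \<in> edge (Q n) e'"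
        using start by blast
      have "e' = i"
        using simple e' i(1) p0 unfolding simple_edges_def by blast
      then obtain N where "\<And>n. n \<ge> N \<Longrightarrow> p n \<in> edge (Q n) i"
        using e'(3) unfolding eventually_sequentially by blast
      then have "p (R N) \<in> edge (Q (R N)) (e (R N))"
        using seq_suble[OF R(1), of N] R(3) by simp
      then show False
        using flight_leaves_edge[OF fl] by blast
    qed
  qed
  have "\<forall>\<^sub>F n in sequentially. \<forall>i\<in>{..<length zs} - {e0}. e n \<noteq> i"
    using other by (intro eventually_ball_finite) auto
  moreover have "e n < length zs" for n
    using fl[of n] len by (simp add: flight_def)
  ultimately show ev_e: "\<forall>\<^sub>F n in sequentially. e n = e0"
    by (auto elim!: eventually_mono)
  \<comment> \<open>Once the edge is \<open>e0\<close>, the hitting time solves the same linear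
    equation as \<open>t n\<close>.\<close>
  have "\<forall>\<^sub>F n in sequentially. t n = s n"
    using ev_e ev_tr
  proof eventually_elim
    case (elim n)
    have "p n + s n *\<^sub>R v n \<in> edge (Q n) e0"
      using fl[of n] edge_interior_subset_edge elim(1) by (auto simp: flight_def)
    then obtain c where "p n + s n *\<^sub>R v n = Q n ! e0 + c *\<^sub>R D n"
      by (auto simp: mem_edge_iff D_def)
    then have "Q n ! e0 - p n = s n *\<^sub>R v n - c *\<^sub>R D n"
      by (simp add: algebra_simps)
    then have "(Q n ! e0 - p n) \<bullet> (\<i> * D n) = s n * (v n \<bullet> (\<i> * D n))"
      using perp[of c "D n"] by (simp add: inner_diff_left)
    then show "t n = s n"
      using elim(2) by (simp add: t_def)
  qed
  then show "s \<longlonglongrightarrow> s0"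
    using t by (rule Lim_transform_eventually[rotated])
qed

lemma tendsto_reflect_in_line:
  assumes "(f \<longlongrightarrow> d) F" "(g \<longlongrightarrow> w) F" "d \<noteq> 0"
  shows "((\<lambda>n. reflect_in_line (f n) (g n)) \<longlongrightarrow> reflect_in_line d w) F"
  unfolding reflect_in_line_def using assms by (intro tendsto_intros) auto

text \<open>Besides convergence, the induction carries the condition on starting points in
  \<open>flight_limit\<close>: initially the limit is inside, and after a bounce the nearby orbits
  leave from the same edge as the limit orbit.\<close>

lemma orbit_limit:
  assumes vt: "verts_tendsto Q zs" and simple: "simple_edges zs"
    and o0: "orbit zs p0 v0 s0 e0" and o: "\<And>n. orbit (Q n) (p n) (v n) (s n) (e n)"
    and init: "(\<lambda>n. p n 0) \<longlonglongrightarrow> p0 0" "(\<lambda>n. v n 0) \<longlonglongrightarrow> v0 0"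
      "p0 0 \<in> inside (polygon_boundary zs)"
  shows "\<forall>\<^sub>F n in sequentially. e n k = e0 k"
proof -
  have o0: "flight zs (p0 k) (v0 k) (s0 k) (e0 k)" "p0 (Suc k) = p0 k + s0 k *\<^sub>R v0 k"
    "v0 (Suc k) = reflect_in_line (side zs (e0 k)) (v0 k)" for k
    using o0 by (auto simp: orbit_def)
  have o: "flight (Q n) (p n k) (v n k) (s n k) (e n k)" "p n (Suc k) = p n k + s n k *\<^sub>R v n k"
    "v n (Suc k) = reflect_in_line (side (Q n) (e n k)) (v n k)" for n k
    using o by (auto simp: orbit_def)
  have "(\<lambda>n. p n k) \<longlonglongrightarrow> p0 k \<and> (\<lambda>n. v n k) \<longlonglongrightarrow> v0 k \<and>
    (p0 k \<in> inside (polygon_boundary zs) \<or> (\<exists>e'<length zs. p0 k \<in> edge_interior zs e' \<and>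
      (\<forall>\<^sub>F n in sequentially. p n k \<in> edge (Q n) e')))" for k
  proof (induction k)
    case 0
    then show ?case using init by simp
  next
    case (Suc k)
    have lim: "\<forall>\<^sub>F n in sequentially. e n k = e0 k" "(\<lambda>n. s n k) \<longlonglongrightarrow> s0 k"
      using flight_limit[OF vt simple _ _ o0(1)[of k] o(1)[of _ k]] Suc by blast+
    have e0: "e0 k < length zs" "p0 (Suc k) \<in> edge_interior zs (e0 k)"
      using o0(1)[of k] by (auto simp: flight_def o0(2))
    have "(\<lambda>n. p n (Suc k)) \<longlonglongrightarrow> p0 (Suc k)"
      unfolding o(2) o0(2) using Suc lim by (intro tendsto_intros) auto
    moreover have "(\<lambda>n. v n (Suc k)) \<longlonglongrightarrow> v0 (Suc k)"
    proof (rule Lim_transform_eventually)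
      show "(\<lambda>n. reflect_in_line (side (Q n) (e0 k)) (v n k)) \<longlonglongrightarrow> v0 (Suc k)"
        unfolding o0(3) using Suc verts_tendsto_side[OF vt e0(1)] flight_side_nonzero[OF o0(1)]
        by (intro tendsto_reflect_in_line) auto
      show "\<forall>\<^sub>F n in sequentially. reflect_in_line (side (Q n) (e0 k)) (v n k) = v n (Suc k)"
        using lim(1) by (rule eventually_mono) (simp add: o(3))
    qed
    moreover have "\<forall>\<^sub>F n in sequentially. p n (Suc k) \<in> edge (Q n) (e0 k)"
      using lim(1)
    proof (rule eventually_mono)
      fix n assume "e n k = e0 k"
      then show "p n (Suc k) \<in> edge (Q n) (e0 k)"
        using o(1)[of n k] edge_interior_subset_edge by (auto simp: flight_def o(2))
    qed
    ultimately show ?case using e0 by blast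
  qed
  then show ?thesis
    using flight_limit(1)[OF vt simple _ _ o0(1)[of k] o(1)[of _ k]] by blast
qed

section \<open>From trajectories to orbits and back\<close>

lemma trajectory_orbit:
  assumes traj: "nonsingular_trajectory zs \<gamma> \<tau> w E"
  obtains p v s where "orbit zs p v s (\<lambda>j. E (k + int j))" "p 0 \<in> inside (polygon_boundary zs)"
proof -
  have tr: "strict_mono \<tau>" "\<And>k. E k < length zs" "\<And>k. \<gamma> (\<tau> k) \<in> edge_interior zs (E k)"
    "\<And>k. cmod (w k) = 1" "\<And>k t. t \<in> {\<tau> k..\<tau> (k + 1)} \<Longrightarrow> \<gamma> t = \<gamma> (\<tau> k) + (t - \<tau> k) *\<^sub>R w k"
    "\<And>k t. t \<in> {\<tau> k<..<\<tau> (k + 1)} \<Longrightarrow> \<gamma> t \<in> inside (polygon_boundary zs)"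
    "\<And>k. w k = reflect_in_line (side zs (E k)) (w (k - 1))"
    using traj unfolding nonsingular_trajectory_def by blast+
  have less: "\<tau> i < \<tau> (i + 1)" for i
    using tr(1) by (simp add: strict_mono_less)
  \<comment> \<open>Starting halfway along the flight before bounce \<open>k\<close> gives a
    starting point inside the table and makes \<open>E k\<close> the first edge hit.\<close>
  define c where "c = (\<tau> (k - 1) + \<tau> k) / 2"
  define T where "T = (\<lambda>j. case j of 0 \<Rightarrow> c | Suc i \<Rightarrow> \<tau> (k + int i))"
  define p where "p = (\<lambda>j. \<gamma> (T j))"
  define v where "v = (\<lambda>j. w (k - 1 + int j))"
  define s where "s = (\<lambda>j. T (Suc j) - T j)"
  have T: "\<tau> (k - 1 + int j) \<le> T j" "T j < \<tau> (k + int j)" "T (Suc j) = \<tau> (k + int j)" for j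
    using less[of "k - 1"] less[of "k - 1 + int j"]
    by (auto simp: T_def c_def algebra_simps split: nat.split)
  have line: "\<gamma> (T j + t) = p j + t *\<^sub>R v j" if "0 \<le> t" "t \<le> s j" for j t
  proof -
    have "T j + t \<in> {\<tau> (k - 1 + int j)..\<tau> (k - 1 + int j + 1)}" "T j \<in> {\<tau> (k - 1 + int j)..\<tau> (k - 1 + int j + 1)}"
      using T[of j] that by (auto simp: s_def)
    from this[THEN tr(5)] show ?thesis
      by (simp add: p_def v_def scaleR_left_diff_distrib scaleR_add_left)
  qed
  have s: "0 < s j" for j
    using T[of j] by (simp add: s_def)
  have p_Suc: "p (Suc j) = p j + s j *\<^sub>R v j" for j
    using line[of "s j" j] s[of j] by (simp add: p_def s_def)
  have "flight zs (p j) (v j) (s j) (E (k + int j))" for j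
    unfolding flight_def
  proof (intro conjI ballI)
    show "p j + s j *\<^sub>R v j \<in> edge_interior zs (E (k + int j))"
      unfolding p_Suc[symmetric] using tr(3) by (simp add: p_def T)
    fix t assume t: "t \<in> {0<..<s j}"
    then have "T j + t \<in> {\<tau> (k - 1 + int j)<..<\<tau> (k - 1 + int j + 1)}"
      using T[of j] by (auto simp: s_def)
    then have "\<gamma> (T j + t) \<in> inside (polygon_boundary zs)"
      by (rule tr(6))
    then show "p j + t *\<^sub>R v j \<in> inside (polygon_boundary zs)"
      using line[of t j] t by simp
  qed (use s tr(2) in auto)
  moreover have "v (Suc j) = reflect_in_line (side zs (E (k + int j))) (v j)" for j
    using tr(7)[of "k + int j"] by (simp add: v_def algebra_simps)
  ultimately have "orbit zs p v s (\<lambda>j. E (k + int j))"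
    unfolding orbit_def using p_Suc tr(4) by (simp add: v_def)
  moreover have "p 0 \<in> inside (polygon_boundary zs)"
  proof -
    have "c \<in> {\<tau> (k - 1)<..<\<tau> (k - 1 + 1)}"
      using less[of "k - 1"] by (simp add: c_def)
    then show ?thesis
      unfolding p_def T_def nat.case by (rule tr(6))
  qed
  ultimately show thesis
    using that by blast
qed

text \<open>Only countably many directions from \<open>x\<close> are singular forward or backward in time.\<close>

lemma regular_trajectory_exists:
  assumes simple: "simple_edges zs" and x: "x \<in> inside (polygon_boundary zs)"
    and "cmod \<theta> = 1" "\<epsilon> > 0"
  obtains p v s e where "orbit zs p v s e" "p 0 = x" "cmod (v 0 - \<theta>) < \<epsilon>"
    "\<exists>\<gamma> \<tau> w E. nonsingular_trajectory zs \<gamma> \<tau> w E \<and> (\<forall>n. E (int n) = e n)"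
proof -
  \<comment> \<open>The negatives are excluded as well because the backward orbit starts in
    direction \<open>- arc \<phi>\<close>.\<close>
  define B where "B = singular_directions zs x \<union> uminus ` singular_directions zs x"
  define arc where "arc = (\<lambda>\<phi>. \<theta> * cis \<phi>)"
  have "(arc \<longlongrightarrow> arc 0) (nhds 0)"
    unfolding arc_def by (intro tendsto_intros filterlim_ident)
  then have "\<forall>\<^sub>F \<phi> in nhds 0. dist (arc \<phi>) (arc 0) < \<epsilon>"
    using \<open>\<epsilon> > 0\<close> by (rule tendstoD)
  then obtain \<delta> where \<delta>: "\<delta> > 0" "\<And>\<phi>. \<bar>\<phi>\<bar> < \<delta> \<Longrightarrow> dist (arc \<phi>) (arc 0) < \<epsilon>"
    by (auto simp: eventually_nhds_metric)
  \<comment> \<open>\<open>h < pi\<close> makes \<open>sin h\<close> positive, so the arc has two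
    distinct points and, being connected, is uncountable; some direction on it avoids
    \<open>B\<close>.\<close>
  define h where "h = min (\<delta> / 2) 1"
  have h: "0 < h" "h < \<delta>" "h < pi"
    using \<delta>(1) pi_gt3 by (auto simp: h_def min_def)
  have "arc h \<noteq> arc 0"
  proof
    assume "arc h = arc 0"
    then have "cis h = cis 0"
      using \<open>cmod \<theta> = 1\<close> by (auto simp: arc_def)
    then have "sin h = 0"
      by (metis cis.simps(2) sin_zero)
    then show False
      using sin_gt_zero[OF h(1,3)] by simp
  qed
  moreover have "connected (arc ` {0..h})"
    unfolding arc_def by (intro connected_continuous_image continuous_intros) auto
  ultimately have "uncountable (arc ` {0..h})"
    using h(1) by (intro connected_uncountable[of _ "arc 0" "arc h"]) auto
  moreover have "countable B"
    unfolding B_def using countable_singular_directions by simp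
  ultimately obtain \<phi> where \<phi>: "\<phi> \<in> {0..h}" "arc \<phi> \<notin> B"
    by (metis countable_subset image_iff subsetI)
  have "- arc \<phi> \<notin> singular_directions zs x"
    using \<phi>(2) unfolding B_def by (metis UnI2 image_eqI minus_minus)
  moreover have "cmod (arc \<phi>) = 1"
    using \<open>cmod \<theta> = 1\<close> by (simp add: arc_def norm_mult)
  ultimately obtain p v s e p' v' s' e' where
    orb: "orbit zs p v s e" "p 0 = x" "v 0 = arc \<phi>"
      "orbit zs p' v' s' e'" "p' 0 = x" "v' 0 = - arc \<phi>"
    using orbit_exists[OF simple x, of "arc \<phi>"] orbit_exists[OF simple x, of "- arc \<phi>"] \<phi>(2)
    unfolding B_def by (metis UnI1 norm_minus_cancel)
  moreover have "cmod (v 0 - \<theta>) < \<epsilon>"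
    using \<delta>(2)[of \<phi>] \<phi>(1) h unfolding orb by (simp add: dist_norm arc_def)
  moreover have "\<exists>\<gamma> \<tau> w E. nonsingular_trajectory zs \<gamma> \<tau> w E \<and> (\<forall>n. E (int n) = e n)"
    using orb x by (intro glue_orbits[OF orb(1,4)]) auto
  ultimately show thesis
    using that by blast
qed

section \<open>Stability of words in the bounce language\<close>

text \<open>If every radius failed, the radii \<open>1 / (n + 1)\<close> would yield tables
  converging to \<open>zs\<close> that lack the word. Regular orbits on them, with directions within
  \<open>1 / (n + 1)\<close> of the given one, eventually produce it.\<close>

lemma word_in_nearby_languages:
  assumes poly: "polygon zs" and word: "word \<in> bounce_language zs lab"
  shows "\<exists>\<epsilon>>0. \<forall>ts\<in>polygon_nbhd zs \<epsilon>. word \<in> bounce_language ts lab"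
proof (rule ccontr)
  assume neg: "\<not> ?thesis"
  obtain \<gamma> \<tau> w E k m where traj: "nonsingular_trajectory zs \<gamma> \<tau> w E"
    and word_eq: "word = map (\<lambda>j. lab (E (k + int j))) [0..<m]"
    using word unfolding bounce_language_def bounce_sequences_def by blast
  obtain p0 v0 s0 where o0: "orbit zs p0 v0 s0 (\<lambda>j. E (k + int j))"
    and x: "p0 0 \<in> inside (polygon_boundary zs)"
    using trajectory_orbit[OF traj] by blast
  have v0: "cmod (v0 0) = 1"
    using o0 by (simp add: orbit_def)
  have "\<exists>ts\<in>polygon_nbhd zs (inverse (real (Suc n))). word \<notin> bounce_language ts lab" for n
    using neg by (metis inverse_positive_iff_positive of_nat_0_less_iff zero_less_Suc)
  then obtain Q where Q: "\<And>n. Q n \<in> polygon_nbhd zs (inverse (real (Suc n)))"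
    "\<And>n. word \<notin> bounce_language (Q n) lab"
    by metis
  have vtQ: "verts_tendsto Q zs"
    unfolding verts_tendsto_def
  proof (intro conjI allI impI)
    show "length (Q n) = length zs" for n
      using Q(1) by (simp add: polygon_nbhd_def)
    fix i assume "i < length zs"
    then have "norm (Q n ! i - zs ! i) \<le> inverse (real (Suc n))" for n
      using Q(1)[of n] by (auto simp: polygon_nbhd_def intro: less_imp_le)
    then have "(\<lambda>n. Q n ! i - zs ! i) \<longlonglongrightarrow> 0"
      by (intro Lim_null_comparison[OF _ LIMSEQ_inverse_real_of_nat] always_eventually allI)
    then show "(\<lambda>n. Q n ! i) \<longlonglongrightarrow> zs ! i"
      by (simp add: LIM_zero_iff)
  qed
  have "\<forall>\<^sub>F n in sequentially. simple_edges (Q n) \<and> p0 0 \<in> inside (polygon_boundary (Q n))"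
    using eventually_simple_edges[OF vtQ poly] eventually_inside[OF vtQ poly x]
    by (rule eventually_conj)
  then obtain K where K: "\<And>n. n \<ge> K \<Longrightarrow> simple_edges (Q n)"
    "\<And>n. n \<ge> K \<Longrightarrow> p0 0 \<in> inside (polygon_boundary (Q n))"
    unfolding eventually_sequentially by blast
  \<comment> \<open>Dropping the first \<open>K\<close> tables makes both properties hold for every
    index, as the choice of a regular trajectory for each \<open>n\<close> requires.\<close>
  define R where "R = (\<lambda>n. Q (n + K))"
  have vtR: "verts_tendsto R zs"
    unfolding R_def by (rule verts_tendsto_subseq[OF vtQ]) (simp add: strict_mono_def)
  have "\<exists>p v s e. orbit (R n) p v s e \<and> p 0 = p0 0 \<and> cmod (v 0 - v0 0) < inverse (real (Suc n)) \<and>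
      (\<exists>\<gamma> \<tau> w E. nonsingular_trajectory (R n) \<gamma> \<tau> w E \<and> (\<forall>j. E (int j) = e j))" for n
    using regular_trajectory_exists[of "R n" "p0 0" "v0 0" "inverse (real (Suc n))"] K[of "n + K"] v0
    unfolding R_def by (metis inverse_positive_iff_positive le_add2 of_nat_0_less_iff zero_less_Suc)
  then obtain p v s e where orb: "\<And>n. orbit (R n) (p n) (v n) (s n) (e n)" "\<And>n. p n 0 = p0 0"
    "\<And>n. cmod (v n 0 - v0 0) < inverse (real (Suc n))"
    "\<And>n. \<exists>\<gamma> \<tau> w E. nonsingular_trajectory (R n) \<gamma> \<tau> w E \<and> (\<forall>j. E (int j) = e n j)"
    by metis
  have "(\<lambda>n. v n 0 - v0 0) \<longlonglongrightarrow> 0"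
    using orb(3) less_imp_le
    by (intro Lim_null_comparison[OF _ LIMSEQ_inverse_real_of_nat] always_eventually allI) blast
  then have "(\<lambda>n. v n 0) \<longlonglongrightarrow> v0 0"
    by (simp add: LIM_zero_iff)
  then have "\<forall>\<^sub>F n in sequentially. e n j = E (k + int j)" for j
    using orbit_limit[OF vtR polygon_simple_edges[OF poly] o0 orb(1) _ _ x] orb(2) by simp
  then have "\<forall>\<^sub>F n in sequentially. \<forall>j\<in>{..<m}. e n j = E (k + int j)"
    by (intro eventually_ball_finite) auto
  then obtain n where n: "\<And>j. j < m \<Longrightarrow> e n j = E (k + int j)"
    unfolding eventually_sequentially by blast
  obtain \<gamma>' \<tau>' w' E' where traj': "nonsingular_trajectory (R n) \<gamma>' \<tau>' w' E'"
    and E': "\<And>j. E' (int j) = e n j"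
    using orb(4) by blast
  have "(\<lambda>k. lab (E' k)) \<in> bounce_sequences (R n) lab"
    unfolding bounce_sequences_def using traj' by blast
  \<comment> \<open>The glued trajectory numbers its first forward bounce 0, so the word read at
    \<open>k\<close> before is now read at 0.\<close>
  moreover have "word = map (\<lambda>j. (\<lambda>k. lab (E' k)) (0 + int j)) [0..<m]"
    using n E' by (simp add: word_eq)
  ultimately have "word \<in> bounce_language (R n) lab"
    unfolding bounce_language_def
    by (intro CollectI exI[of _ "\<lambda>k. lab (E' k)"] exI[of _ "0::int"] exI[of _ m] conjI)
  then show False
    using Q(2) by (simp add: R_def)
qed

lemma polygon_nbhd_mono: "\<delta> \<le> \<epsilon> \<Longrightarrow> polygon_nbhd zs \<delta> \<subseteq> polygon_nbhd zs \<epsilon>"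
  unfolding polygon_nbhd_def by fastforce

theorem theorem6p3:
  fixes zs :: "complex list" and A :: "'a set" and lab :: "nat \<Rightarrow> 'a" and W :: "'a list set"
  assumes "normalized_polygon zs"
    and "edge_labeling A (length zs) lab"
    and "finite W"
    and "W \<subseteq> bounce_language zs lab"
  shows "\<exists>\<epsilon>>0. \<forall>ts\<in>polygon_nbhd zs \<epsilon>. W \<subseteq> bounce_language ts lab"
proof -
  have poly: "polygon zs"
    using assms(1) by (simp add: normalized_polygon_def)
  show ?thesis
    using assms(3,4)
  proof (induction W rule: finite_induct)
    case empty
    then show ?case by (auto intro: exI[of _ 1])
  next
    case (insert word W)
    then obtain \<epsilon> where \<epsilon>: "\<epsilon> > 0" "\<forall>ts\<in>polygon_nbhd zs \<epsilon>. W \<subseteq> bounce_language ts lab"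
      by auto
    obtain \<delta> where \<delta>: "\<delta> > 0" "\<forall>ts\<in>polygon_nbhd zs \<delta>. word \<in> bounce_language ts lab"
      using word_in_nearby_languages[OF poly, of word lab] insert.prems by auto
    show ?case
    proof (intro exI[of _ "min \<epsilon> \<delta>"] conjI ballI)
      fix ts assume "ts \<in> polygon_nbhd zs (min \<epsilon> \<delta>)"
      then have "ts \<in> polygon_nbhd zs \<epsilon>" "ts \<in> polygon_nbhd zs \<delta>"
        by (auto intro: subsetD[OF polygon_nbhd_mono, rotated])
      then show "insert word W \<subseteq> bounce_language ts lab"
        using \<epsilon>(2) \<delta>(2) by simp
    qed (use \<epsilon> \<delta> in simp)
  qed
qed

end
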